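(* Let $k$ be an integer and let $\mathcal P\subset\mathbb{R}^n$ be an $(n-1)$-dimensional polytope contained in the hyperplane $x_1+\dots+x_n=k$, all of whose points have nonnegative coordinates. Then the following are equivalent: (1) $\mathcal P$ is an alcoved polytope; (2) the collection $\{I_a: a\in Z_{\mathcal P}\}$ of multisets is sort-closed, and the $(n-1)$-dimensional simplices $\mathrm{conv}\{a_1,\dots,a_n\}$, where $a_1,\dots,a_n\in Z_{\mathcal P}$ are such that $(I_{a_1},\dots,I_{a_n})$ is a sorted collection, are the maximal simplices of a triangulation of $\mathcal P$; (3) the simplices $\mathrm{conv}\{c^{(1)},\dots,c^{(n)}\}$, where $(c^{(1)},\dots,c^{(n)})$ ranges over the minimal circuits of $G_{\mathcal P}$, are the maximal simplices of a triangulation of $\mathcal P$. Moreover, when these conditions hold, the triangulations in (2) and (3) and the triangulation of $\mathcal P$ into alcoves all coincide.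
   Context: Alcoved polytope (in $x$-coordinates): a polytope $\mathcal P$ in the hyperplane $x_1+\dots+x_n=k$ which is the intersection of this hyperplane with finitely many half-spaces of the form $x_{i+1}+\dots+x_j\le c$ or $x_{i+1}+\dots+x_j\ge b$, with $0\le i<j\le n-1$ and $b,c\in\mathbb{Z}$. Alcoves: the closures of the connected components of the complement, in the hyperplane $x_1+\dots+x_n=k$, of the union of the hyperplanes $x_{i+1}+\dots+x_j=l$ ($0\le i<j\le n-1$, $l\in\mathbb{Z}$). $Z_{\mathcal P}=\mathcal P\cap\mathbb{Z}^n$. For $a=(a_1,\dots,a_n)\in\mathbb{Z}_{\ge0}^n$ with $\sum a_i=k$, $I_a$ is the multiset of size $k$ on $[n]$ containing $a_i$ copies of $i$. For multisets $I,J$ of size $k$ on $[n]$, let $(s_1,\dots,s_{2k})$ be the nondecreasing ordering of the multiset union of $I$ and $J$, and set $U(I,J)=\{s_1,s_3,\dots,s_{2k-1}\}$, $V(I,J)=\{s_2,s_4,\dots,s_{2k}\}$ (multisets). A pair $(I,J)$ is sorted if $I=U(I,J)$, $J=V(I,J)$; an ordered collection is sorted if each pair $(I_i,I_j)$ with $i<j$ is sorted; a collection $\mathcal S$ of multisets is sort-closed if $U(I,J),V(I,J)\in\mathcal S$ for all $I,J\in\mathcal S$. $G_{\mathcal P}$ is the directed graph with vertex set $Z_{\mathcal P}$ and an edge $a\to b$ labelled $i\in[n]$ whenever $b=a+e_{i+1}-e_i$, where $e_i$ are the standard basis vectors and $e_{n+1}:=e_1$. Every directed circuit in $G_{\mathcal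 P}$ has length a multiple of $n$; the minimal circuits are the directed circuits of length $n$, written as the sequence $(c^{(1)},\dots,c^{(n)})$ of their vertices. *)

theory Defs
  imports
    "HOL-Analysis.Analysis"
    "HOL-Library.Multiset"
    "Graph_Theory.Arc_Walk"
begin

text \<open>
  The index set \<open>[n]\<close> is an arbitrary type \<open>'n\<close> that is finite and linearly ordered, so that
  \<open>n = CARD('n)\<close>, the least element is \<open>1\<close> and the greatest element is \<open>n\<close>.
\<close>

definition sum_hyperplane :: "int \<Rightarrow> (real ^ 'n::finite) set" where
  "sum_hyperplane k = {x. (\<Sum>i\<in>UNIV. x $ i) = of_int k}"

text \<open>
  In \<open>x\<^bsub>i+1\<^esub> + \<dots> + x\<^bsub>j\<^esub>\<close> with \<open>0 \<le> i < j \<le> n - 1\<close> the indices run over an interval \<open>{p..q}\<close> where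
  \<open>p = i + 1 \<le> q = j\<close> and \<open>q\<close> is not the last index.
\<close>

definition alcove_halfspaces :: "(real ^ 'n::{finite,linorder}) set set" where
  "alcove_halfspaces =
     {{x. (\<Sum>m\<in>{p..q}. x $ m) \<le> of_int c} | p q (c::int). p \<le> q \<and> q < Max UNIV} \<union>
     {{x. (\<Sum>m\<in>{p..q}. x $ m) \<ge> of_int b} | p q (b::int). p \<le> q \<and> q < Max UNIV}"

definition alcove_hyperplanes :: "(real ^ 'n::{finite,linorder}) set set" where
  "alcove_hyperplanes =
     {{x. (\<Sum>m\<in>{p..q}. x $ m) = of_int l} | p q (l::int). p \<le> q \<and> q < Max UNIV}"

definition alcoved_polytope :: "int \<Rightarrow> (real ^ 'n::{finite,linorder}) set \<Rightarrow> bool" where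
  "alcoved_polytope k P \<longleftrightarrow>
     polytope P \<and>
     (\<exists>H. finite H \<and> H \<subseteq> alcove_halfspaces \<and> P = sum_hyperplane k \<inter> \<Inter>H)"

definition alcoves :: "int \<Rightarrow> (real ^ 'n::{finite,linorder}) set set" where
  "alcoves k = closure ` components (sum_hyperplane k - \<Union>alcove_hyperplanes)"

definition lattice_points :: "(real ^ 'n::finite) set \<Rightarrow> (real, 'n) vec set" where
  "lattice_points P = {a \<in> P. \<forall>i. a $ i \<in> \<int>}"

text \<open>Only meaningful for vectors with nonnegative integer coordinates.\<close>

definition index_mset :: "real ^ 'n::{finite,linorder} \<Rightarrow> 'n multiset" where
  "index_mset a = (\<Sum>i\<in>UNIV. replicate_mset (nat \<lfloor>a $ i\<rfloor>) i)"

text \<open>List positions start at 0, so \<open>s\<^sub>1, s\<^sub>3, \<dots>\<close> sit at the even positions.\<close>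

definition sort_U :: "'a::linorder multiset \<Rightarrow> 'a multiset \<Rightarrow> 'a multiset" where
  "sort_U I J = mset (nths (sorted_list_of_multiset (I + J)) {i. even i})"

definition sort_V :: "'a::linorder multiset \<Rightarrow> 'a multiset \<Rightarrow> 'a multiset" where
  "sort_V I J = mset (nths (sorted_list_of_multiset (I + J)) {i. odd i})"

definition sorted_pair :: "'a::linorder multiset \<Rightarrow> 'a multiset \<Rightarrow> bool" where
  "sorted_pair I J \<longleftrightarrow> I = sort_U I J \<and> J = sort_V I J"

definition sorted_collection :: "'a::linorder multiset list \<Rightarrow> bool" where
  "sorted_collection Is \<longleftrightarrow> sorted_wrt sorted_pair Is"

definition sort_closed :: "'a::linorder multiset set \<Rightarrow> bool" where
  "sort_closed S \<longleftrightarrow> (\<forall>I\<in>S. \<forall>J\<in>S. sort_U I J \<in> S \<and> sort_V I J \<in> S)"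

definition cyclic_succ :: "'n::{finite,linorder} \<Rightarrow> 'n" where
  "cyclic_succ i = (if i = Max UNIV then Min UNIV else Min {i<..})"

text \<open>An arc \<open>(a, i, b)\<close> is the edge \<open>a \<rightarrow> b\<close> together with its label \<open>i\<close>.\<close>

definition lattice_graph ::
    "(real ^ 'n::{finite,linorder}) set \<Rightarrow>
     ((real, 'n) vec, (real, 'n) vec \<times> 'n \<times> (real, 'n) vec) pre_digraph" where
  "lattice_graph P =
     \<lparr>verts = lattice_points P,
      arcs = {(a, i, b) | a i b. a \<in> lattice_points P \<and> b \<in> lattice_points P \<and>
                b = a + axis (cyclic_succ i) 1 - axis i 1},
      tail = (\<lambda>(a, i, b). a),
      head = (\<lambda>(a, i, b). b)\<rparr>"

definition minimal_circuits :: "(real ^ 'n::{finite,linorder}) set \<Rightarrow> (real, 'n) vec list set" where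
  "minimal_circuits P =
     {map (tail (lattice_graph P)) p | p.
        pre_digraph.cycle (lattice_graph P) p \<and> length p = CARD('n)}"

definition maximal_simplices_of_triangulation :: "'a::euclidean_space set set \<Rightarrow> 'a set \<Rightarrow> bool" where
  "maximal_simplices_of_triangulation \<T> P \<longleftrightarrow>
     (\<exists>\<K>. simplicial_complex \<K> \<and> \<Union>\<K> = P \<and>
          \<T> = {S \<in> \<K>. \<forall>S'\<in>\<K>. S \<subseteq> S' \<longrightarrow> S' = S})"

definition sorted_simplices :: "(real ^ 'n::{finite,linorder}) set \<Rightarrow> (real, 'n) vec set set" where
  "sorted_simplices P =
     {convex hull (set as) | as.
        length as = CARD('n) \<and> set as \<subseteq> lattice_points P \<and>
        sorted_collection (map index_mset as) \<and>
        (int CARD('n) - 1) simplex (convex hull (set as))}"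

definition circuit_simplices :: "(real ^ 'n::{finite,linorder}) set \<Rightarrow> (real, 'n) vec set set" where
  "circuit_simplices P = {convex hull (set c) | c. c \<in> minimal_circuits P}"

definition alcoves_in :: "int \<Rightarrow> (real ^ 'n::{finite,linorder}) set \<Rightarrow> (real, 'n) vec set set" where
  "alcoves_in k P = {A \<in> alcoves k. A \<subseteq> P}"

end

theory Submission
  imports Defs
begin

text \<open>
  In terms of the partial sums \<open>y\<^sub>j = x\<^sub>1 + \<dots> + x\<^sub>j\<close> the alcove hyperplanes are the loci
  \<open>y\<^sub>j - y\<^sub>i \<in> \<int>\<close> with \<open>0 \<le> i < j < n\<close>. For \<open>0 \<le> t < 1\<close> round a point \<open>x\<close> of the hyperplane to the
  lattice point with partial sums \<open>\<lfloor>y\<^sub>j + t\<rfloor>\<close>. As \<open>t\<close> varies these lattice points form a chain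
  \<open>v\<^sub>0 \<le> \<dots> \<le> v\<^sub>r \<le> v\<^sub>0 + 1\<close> (comparing partial sums coordinatewise), and \<open>x\<close> is the average of its
  roundings. Conversely, in any representation of \<open>x\<close> as a convex combination of such a chain the
  coefficient of \<open>v\<close> is the length of the set of times \<open>t\<close> at which \<open>x\<close> rounds to \<open>v\<close>. Hence the
  convex hulls of chains form a simplicial complex. Its maximal simplices come from the chains with
  \<open>n\<close> elements, and these are at the same time the alcoves, the sorted collections and the minimal
  circuits.

  Rounding preserves integral bounds on \<open>y\<^sub>j - y\<^sub>i\<close>, so an alcoved polytope contains the chain of each
  of its points and is triangulated by the chains it contains. Conversely, if a convex \<open>P\<close> is a union
  of alcoves, each facet of \<open>P\<close> contains a facet of an alcove and thus lies in an alcove hyperplane.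
\<close>

subsection \<open>Partial sums\<close>

text \<open>The weight of a lattice point \<open>v\<close> in \<open>x\<close> is defined from
  \<open>x\<close> and \<open>v\<close> alone, with no chain mentioned. This is what makes
  coefficients over different chains comparable. Only an inequality has to be computed: over a
  chain, each coefficient is at most the weight. The coefficients sum to one, and the rounding times
  of distinct lattice points are disjoint subsets of the unit interval, so all these inequalities
  are equalities. Uniqueness of the coefficients yields both the affine independence of a chain and
  the fact that two hulls meet in the hull of the common vertices.

  Under the hypotheses of the theorem the alcoves in \<open>P\<close>, the sorted simplices and the
  circuit simplices are all the same family \<open>chain_simplices k P\<close>, whether or not
  \<open>P\<close> is alcoved. What remains is one equivalence: \<open>P\<close> is alcoved iff this
  family triangulates it. The obstacle in the converse is that a cover by alcoves gives no
  inequality for \<open>P\<close> directly; a category argument finds an alcove that meets a given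
  facet in full dimension, and its wall supplies the inequality.\<close>

definition idx :: "'n::{finite,linorder} \<Rightarrow> nat" where
  "idx m = card {..<m}"

text \<open>The index \<open>j\<close> runs over all naturals. From \<open>j = n\<close> on the
  value is the total, so later conditions can quantify over every \<open>j\<close> without a
  range.\<close>

definition psum :: "nat \<Rightarrow> real ^ 'n::{finite,linorder} \<Rightarrow> real" where
  "psum j x = (\<Sum>m | idx m < j. x $ m)"

lemma idx_mono: "m < m' \<Longrightarrow> idx m < idx (m' :: 'n::{finite,linorder})"
  unfolding idx_def by (rule psubset_card_mono) auto

lemma idx_less_iff [simp]: "idx m < idx m' \<longleftrightarrow> m < (m' :: 'n::{finite,linorder})"
  by (metis idx_mono less_asym neqE)

lemma idx_le_iff [simp]: "idx m \<le> idx m' \<longleftrightarrow> m \<le> (m' :: 'n::{finite,linorder})"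
  by (meson idx_less_iff not_le)

lemma idx_eq_iff [simp]: "idx m = idx m' \<longleftrightarrow> m = (m' :: 'n::{finite,linorder})"
  by (metis idx_less_iff less_irrefl neqE)

lemma idx_bound [simp]: "idx (m :: 'n::{finite,linorder}) < CARD('n)"
  unfolding idx_def by (rule psubset_card_mono) auto

lemma range_idx: "range (idx :: 'n::{finite,linorder} \<Rightarrow> nat) = {..<CARD('n)}"
proof (rule card_subset_eq)
  show "card (range (idx :: 'n \<Rightarrow> nat)) = card {..<CARD('n)}"
    by (simp add: card_image inj_def)
qed auto

lemma idx_surj:
  assumes "j < CARD('n::{finite,linorder})"
  obtains m :: "'n::{finite,linorder}" where "idx m = j"
  using assms range_idx[where 'n='n] by (metis imageE lessThan_iff)

lemma idx_Max: "Suc (idx (Max UNIV :: 'n::{finite,linorder})) = CARD('n)"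
proof -
  have "{..<Max UNIV :: 'n} = UNIV - {Max UNIV}"
    by (auto simp: order_less_le)
  then show ?thesis
    unfolding idx_def using finite_UNIV_card_ge_0[where 'a='n] by (simp add: card_Diff_singleton)
qed

lemma idx_Min: "idx (Min UNIV :: 'n::{finite,linorder}) = 0"
  unfolding idx_def by (auto simp: not_less)

lemma less_Max_iff: "q < (Max UNIV :: 'n::{finite,linorder}) \<longleftrightarrow> Suc (idx q) < CARD('n)"
  by (metis Suc_less_eq idx_Max idx_less_iff)

lemma idx_cyclic_succ:
  "idx (cyclic_succ i) = (if Suc (idx i) = CARD('n) then 0 else Suc (idx (i::'n::{finite,linorder})))"
proof (cases "i = Max UNIV")
  case True
  then show ?thesis by (simp add: cyclic_succ_def idx_Max idx_Min)
next
  case False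
  then have "i < Max UNIV"
    by (simp add: order_less_le)
  then have lt: "Suc (idx i) < CARD('n)"
    by (simp add: less_Max_iff)
  then obtain m :: 'n where m: "idx m = Suc (idx i)"
    by (rule idx_surj)
  have "Min {i<..} = m"
  proof (rule Min_eqI)
    show "m \<le> y" if "y \<in> {i<..}" for y
      using that m by (metis Suc_leI greaterThan_iff idx_le_iff idx_less_iff)
    show "m \<in> {i<..}"
      using m by (metis greaterThan_iff idx_less_iff lessI)
  qed auto
  with False lt m show ?thesis by (simp add: cyclic_succ_def)
qed

lemma psum_0 [simp]: "psum 0 x = 0"
  by (simp add: psum_def)

lemma psum_ge_CARD: "CARD('n) \<le> j \<Longrightarrow> psum j (x :: real ^ 'n::{finite,linorder}) = (\<Sum>m\<in>UNIV. x $ m)"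
proof -
  assume "CARD('n) \<le> j"
  then have "{m :: 'n. idx m < j} = UNIV"
    using idx_bound[where 'n='n] by (blast intro: less_le_trans)
  then show ?thesis by (simp add: psum_def)
qed

lemma psum_Suc_idx: "psum (Suc (idx m)) x = psum (idx m) x + x $ m"
proof -
  have "{m'. idx m' < Suc (idx m)} = insert m {m'. idx m' < idx m}"
    by (auto simp: less_Suc_eq simp del: idx_less_iff)
  then show ?thesis by (simp add: psum_def)
qed

lemma psum_interval:
  assumes "p \<le> q"
  shows "(\<Sum>m\<in>{p..q}. x $ m) = psum (Suc (idx q)) x - psum (idx p) x"
proof -
  have "{m. idx m < Suc (idx q)} = {m. idx m < idx p} \<union> {p..q}"
    using assms by (auto simp: less_Suc_eq_le)
  moreover have "{m. idx m < idx p} \<inter> {p..q} = {}"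
    by auto
  ultimately show ?thesis
    unfolding psum_def by (simp add: sum.union_disjoint)
qed

lemma psum_add [simp]: "psum j (x + y) = psum j x + psum j y"
  by (simp add: psum_def sum.distrib)

lemma psum_diff [simp]: "psum j (x - y) = psum j x - psum j y"
  by (simp add: psum_def sum_subtractf)

lemma psum_scaleR [simp]: "psum j (c *\<^sub>R x) = c * psum j x"
  by (simp add: psum_def sum_distrib_left)

lemma psum_sum: "psum j (\<Sum>v\<in>A. f v) = (\<Sum>v\<in>A. psum j (f v))"
  unfolding psum_def sum_component by (rule sum.swap)

lemma psum_axis: "psum j (axis i c) = (if idx i < j then c else 0)"
  by (simp add: psum_def axis_def)

lemma psum_eqI:
  assumes "\<And>j. psum j x = psum j y"
  shows "x = y"
proof -
  have "x $ m = y $ m" for m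
    using psum_Suc_idx[of m x] psum_Suc_idx[of m y] assms by simp
  then show ?thesis by (simp add: vec_eq_iff)
qed

text \<open>Normal vector of the walls. Written as inner products, gaps fall under the library facts
  on hyperplanes, half-spaces and supporting faces. No order of \<open>i\<close> and
  \<open>j\<close> is imposed.\<close>

definition gap_vec :: "nat \<Rightarrow> nat \<Rightarrow> real ^ 'n::{finite,linorder}" where
  "gap_vec i j = (\<chi> m. (if idx m < j then 1 else 0) - (if idx m < i then 1 else 0))"

lemma inner_gap_vec: "gap_vec i j \<bullet> x = psum j x - psum i x"
  unfolding gap_vec_def psum_def inner_vec_def
  by (simp add: left_diff_distrib sum_subtractf if_distrib[of "\<lambda>c. c * _"] sum.If_cases
      cong: if_cong)

lemma continuous_on_psum [continuous_intros]: "continuous_on S (psum j)"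
  unfolding psum_def by (intro continuous_intros)

definition of_psums :: "(nat \<Rightarrow> real) \<Rightarrow> real ^ 'n::{finite,linorder}" where
  "of_psums g = (\<chi> m. g (Suc (idx m)) - g (idx m))"

lemma psum_of_psums:
  assumes "j \<le> CARD('n)"
  shows "psum j (of_psums g :: real ^ 'n::{finite,linorder}) = g j - g 0"
  using assms
proof (induction j)
  case (Suc j)
  then obtain m :: 'n where m: "idx m = j"
    by (metis Suc_le_eq idx_surj)
  have "psum (Suc j) (of_psums g :: (real, 'n) vec) = psum j (of_psums g :: (real, 'n) vec) + (g (Suc j) - g j)"
    using psum_Suc_idx[of m "of_psums g"] m by (simp add: of_psums_def)
  then show ?case using Suc by simp
qed simp

lemma mem_sum_hyperplane: "x \<in> sum_hyperplane k \<longleftrightarrow> psum CARD('n) (x :: real ^ 'n::{finite,linorder}) = of_int k"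
  by (simp add: sum_hyperplane_def psum_ge_CARD)

lemma psum_hyperplane_ge:
  "x \<in> sum_hyperplane k \<Longrightarrow> CARD('n) \<le> j \<Longrightarrow> psum j (x :: real ^ 'n::{finite,linorder}) = of_int k"
  by (simp add: sum_hyperplane_def psum_ge_CARD)

lemma psum_Ints: "(\<And>i. v $ i \<in> \<int>) \<Longrightarrow> psum j v \<in> \<int>"
  unfolding psum_def by (rule Ints_sum) simp

lemma Ints_of_psum: "(\<And>j. psum j v \<in> \<int>) \<Longrightarrow> v $ i \<in> \<int>"
  using psum_Suc_idx[of i v] by (metis Ints_diff add_diff_cancel_left')

lemma sum_hyperplane_eq_inner: "sum_hyperplane k = {x :: real ^ 'n::{finite,linorder}. gap_vec 0 CARD('n) \<bullet> x = of_int k}"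
  by (auto simp: inner_gap_vec mem_sum_hyperplane)

lemma gap_vec_nonzero:
  assumes "i < j" "j \<le> CARD('n)"
  shows "gap_vec i j \<noteq> (0 :: real ^ 'n::{finite,linorder})"
proof -
  obtain m :: 'n where "idx m = i"
    using assms by (meson idx_surj less_le_trans)
  then have "gap_vec i j $ m = 1"
    using assms by (simp add: gap_vec_def)
  then show ?thesis by auto
qed

lemma affine_sum_hyperplane: "affine (sum_hyperplane k :: (real ^ 'n::{finite,linorder}) set)"
  by (simp add: sum_hyperplane_eq_inner affine_hyperplane)

lemma aff_dim_sum_hyperplane:
  "aff_dim (sum_hyperplane k :: (real ^ 'n::{finite,linorder}) set) = int CARD('n) - 1"
  using gap_vec_nonzero[of 0 "CARD('n)", where 'n='n] by (simp add: sum_hyperplane_eq_inner)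

text \<open>Dictionary between a gap of partial sums and an interval of coordinates: the sums are
  taken at the boundaries of the interval, hence the shift by one at \<open>q\<close>.\<close>

lemma idx_pair:
  assumes "i < j" "j < CARD('n)"
  obtains p q :: "'n::{finite,linorder}" where "idx p = i" "Suc (idx q) = j" "p \<le> q" "q < Max UNIV"
proof -
  have "i < CARD('n)" "j - 1 < CARD('n)"
    using assms by auto
  then obtain p q :: 'n where pq: "idx p = i" "idx q = j - 1"
    by (metis idx_surj)
  then have "Suc (idx q) = j" "idx p \<le> idx q"
    using assms by auto
  with pq(1) show thesis
    using that assms(2) by (metis idx_le_iff less_Max_iff)
qed

text \<open>Moving a unit of mass from the last coordinate to coordinate \<open>i\<close> changes the gap, so no wall
  contains the whole hyperplane.\<close>

lemma aff_dim_wall: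
  assumes "i < j" "j < CARD('n)"
  shows "aff_dim (sum_hyperplane k \<inter> {x :: real ^ 'n::{finite,linorder}. psum j x - psum i x = c})
    \<le> int CARD('n) - 2"
proof -
  let ?H = "sum_hyperplane k :: ((real, 'n) vec) set"
  have "\<not> ?H \<subseteq> {x. gap_vec i j \<bullet> x = c}"
  proof
    assume sub: "?H \<subseteq> {x. gap_vec i j \<bullet> x = c}"
    obtain m :: 'n where m: "idx m = i"
      using assms by (meson idx_surj less_trans)
    obtain x :: "(real, 'n) vec" where x: "x \<in> ?H"
      using aff_dim_sum_hyperplane[of k, where 'n='n] assms by fastforce
    let ?y = "x + axis m 1 - axis (Max UNIV) 1"
    have "idx (Max UNIV :: 'n) = CARD('n) - 1"
      using idx_Max[where 'n='n] by simp
    then have gap: "psum j ?y - psum i ?y = psum j x - psum i x + 1"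
      using assms m by (simp add: psum_axis)
    have "?y \<in> ?H"
      using x by (simp add: mem_sum_hyperplane psum_axis)
    then show False
      using sub x gap unfolding inner_gap_vec by (metis (mono_tags) add_cancel_left_right mem_Collect_eq subsetD zero_neq_one)
  qed
  moreover have "0 \<le> int CARD('n) - 2"
    using assms by simp
  ultimately show ?thesis
    using aff_dim_affine_Int_hyperplane[OF affine_sum_hyperplane[of k], of "gap_vec i j" c]
      aff_dim_sum_hyperplane[of k, where 'n='n]
    by (auto simp: inner_gap_vec split: if_splits)
qed

lemma Union_alcove_hyperplanes:
  "\<Union>alcove_hyperplanes = {x :: real ^ 'n::{finite,linorder}.
     \<exists>i j. i < j \<and> j < CARD('n) \<and> psum j x - psum i x \<in> \<int>}" (is "_ = ?R")
proof (intro equalityI subsetI)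
  fix x :: "(real, 'n) vec"
  assume "x \<in> \<Union>alcove_hyperplanes"
  then obtain p q :: 'n and l :: int where "p \<le> q" "q < Max UNIV" "(\<Sum>m\<in>{p..q}. x $ m) = of_int l"
    unfolding alcove_hyperplanes_def by auto
  then have "idx p < Suc (idx q)" "Suc (idx q) < CARD('n)" "psum (Suc (idx q)) x - psum (idx p) x \<in> \<int>"
    by (simp_all add: psum_interval less_Max_iff less_Suc_eq_le)
  then show "x \<in> ?R"
    by blast
next
  fix x :: "(real, 'n) vec"
  assume "x \<in> ?R"
  then obtain i j l where ij: "i < j" "j < CARD('n)" and l: "psum j x - psum i x = of_int l"
    by (auto elim: Ints_cases)
  obtain p q :: 'n where p: "idx p = i" and q: "Suc (idx q) = j" and "p \<le> q" "q < Max UNIV"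
    using idx_pair[OF ij] by blast
  moreover have "(\<Sum>m\<in>{p..q}. x $ m) = of_int l"
    using l p q \<open>p \<le> q\<close> by (simp add: psum_interval)
  ultimately show "x \<in> \<Union>alcove_hyperplanes"
    unfolding alcove_hyperplanes_def by blast
qed

text \<open>Lower bounds on a gap are upper bounds on the gap with \<open>i\<close> and \<open>j\<close> exchanged.\<close>

lemma alcoved_polytope_memI:
  assumes "alcoved_polytope k P" "S \<subseteq> P" and u: "u \<in> sum_hyperplane k"
    and gaps: "\<And>i j (c::int). (\<And>x. x \<in> S \<Longrightarrow> psum j x - psum i x \<le> of_int c) \<Longrightarrow>
      psum j u - psum i u \<le> of_int c"
  shows "u \<in> P"
proof -
  obtain \<H> where \<H>: "\<H> \<subseteq> alcove_halfspaces" and P: "P = sum_hyperplane k \<inter> \<Inter>\<H>"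
    using assms(1) unfolding alcoved_polytope_def by blast
  have "u \<in> h" if h: "h \<in> \<H>" for h
  proof -
    have S: "S \<subseteq> h"
      using assms(2) P h by auto
    have "h \<in> alcove_halfspaces"
      using h \<H> by blast
    then consider
        p q c where "h = {x. (\<Sum>m\<in>{p..q}. x $ m) \<le> of_int c}" "p \<le> q"
      | p q b where "h = {x. (\<Sum>m\<in>{p..q}. x $ m) \<ge> of_int b}" "p \<le> q"
      unfolding alcove_halfspaces_def by auto
    then show ?thesis
    proof cases
      case 1
      then show ?thesis
        using S gaps[where c=c] by (auto simp: psum_interval)
    next
      case 2
      have "psum (idx p) u - psum (Suc (idx q)) u \<le> of_int (- b)"
        using S 2 by (intro gaps) (force simp: psum_interval)
      then show ?thesis
        using 2 by (auto simp: psum_interval)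
    qed
  qed
  then show ?thesis
    using u P by blast
qed

text \<open>Each interval of coordinates contributes two half-spaces: the bound for
  \<open>(i, j)\<close> is an upper bound, and the bound for \<open>(j, i)\<close>, negated, is a
  lower bound of the same sum. There are finitely many intervals.\<close>

lemma alcoved_polytopeI:
  fixes P :: "(real ^ 'n::{finite,linorder}) set" and c :: "nat \<Rightarrow> nat \<Rightarrow> int"
  assumes "polytope P"
    and P: "P = {z \<in> sum_hyperplane k. \<forall>i<CARD('n). \<forall>j<CARD('n). i \<noteq> j \<longrightarrow> psum j z - psum i z \<le> of_int (c i j)}"
  shows "alcoved_polytope k P"
proof -
  let ?up = "\<lambda>(p, q). {x :: (real, 'n) vec. (\<Sum>m\<in>{p..q}. x $ m) \<le> of_int (c (idx p) (Suc (idx q)))}"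
  let ?lo = "\<lambda>(p, q). {x :: (real, 'n) vec. (\<Sum>m\<in>{p..q}. x $ m) \<ge> of_int (- c (Suc (idx q)) (idx p))}"
  let ?I = "{(p, q). p \<le> q \<and> q < (Max UNIV :: 'n)}"
  define \<H> where "\<H> = ?up ` ?I \<union> ?lo ` ?I"
  have "?up ` ?I \<subseteq> alcove_halfspaces"
    unfolding alcove_halfspaces_def by auto
  moreover have "?lo ` ?I \<subseteq> alcove_halfspaces"
    unfolding alcove_halfspaces_def
  proof (intro subsetI UnI2)
    fix h assume "h \<in> ?lo ` ?I"
    then obtain p q where "p \<le> q" "q < Max UNIV" "h = ?lo (p, q)"
      by blast
    then have "h = {x. (\<Sum>m\<in>{p..q}. x $ m) \<ge> of_int (- c (Suc (idx q)) (idx p))} \<and> p \<le> q \<and> q < Max UNIV"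
      by simp
    then show "h \<in> {{x. (\<Sum>m\<in>{p..q}. x $ m) \<ge> of_int b} | p q (b::int). p \<le> q \<and> q < Max UNIV}"
      by blast
  qed
  ultimately have \<H>: "finite \<H>" "\<H> \<subseteq> alcove_halfspaces"
    unfolding \<H>_def by auto
  have "P = sum_hyperplane k \<inter> \<Inter>\<H>"
  proof (intro equalityI subsetI)
    fix z assume z: "z \<in> P"
    then show "z \<in> sum_hyperplane k \<inter> \<Inter>\<H>"
      unfolding \<H>_def
    proof (intro IntI InterI; (elim UnE imageE)?)
      show "z \<in> sum_hyperplane k" using z P by blast
    next
      fix h pq assume *: "h = ?up pq" "pq \<in> ?I"
      obtain p q where pq: "pq = (p, q)" by fastforce
      have "idx p \<noteq> Suc (idx q)"
        using * pq idx_le_iff[of p q] by (auto simp del: idx_le_iff)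
      then have "psum (Suc (idx q)) z - psum (idx p) z \<le> of_int (c (idx p) (Suc (idx q)))"
        using z P * pq by (auto simp: less_Max_iff)
      then show "z \<in> h"
        using * pq by (simp add: psum_interval)
    next
      fix h pq assume *: "h = ?lo pq" "pq \<in> ?I"
      obtain p q where pq: "pq = (p, q)" by fastforce
      have "idx p \<noteq> Suc (idx q)"
        using * pq idx_le_iff[of p q] by (auto simp del: idx_le_iff)
      then have "psum (idx p) z - psum (Suc (idx q)) z \<le> of_int (c (Suc (idx q)) (idx p))"
        using z P * pq by (auto simp: less_Max_iff)
      then show "z \<in> h"
        using * pq by (simp add: psum_interval)
    qed
  next
    fix z assume z: "z \<in> sum_hyperplane k \<inter> \<Inter>\<H>"
    have "psum j z - psum i z \<le> of_int (c i j) \<and> psum i z - psum j z \<le> of_int (c j i)"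
      if ij: "i < j" "j < CARD('n)" for i j
    proof -
      obtain p q :: 'n where p: "idx p = i" and q: "Suc (idx q) = j" and pq: "p \<le> q" and "q < Max UNIV"
        using idx_pair[OF ij] by blast
      then have "(p, q) \<in> ?I"
        by simp
      then have "?up (p, q) \<in> \<H>" "?lo (p, q) \<in> \<H>"
        unfolding \<H>_def by blast+
      then have "z \<in> ?up (p, q)" "z \<in> ?lo (p, q)"
        using z by blast+
      then show ?thesis
        using p q pq by (simp add: psum_interval)
    qed
    then show "z \<in> P"
      unfolding P using z by (auto simp: nat_neq_iff)
  qed
  then show ?thesis
    using assms(1) \<H> unfolding alcoved_polytope_def by blast
qed

subsection \<open>Chains of lattice points and barycentric weights\<close>

text \<open>The vector \<open>w\<close> arises from \<open>v\<close> by raising some partial sums by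
  at most one. The relation is not transitive, so chains require it for all pairs.\<close>

definition near :: "real ^ 'n::{finite,linorder} \<Rightarrow> (real, 'n) vec \<Rightarrow> bool" where
  "near v w \<longleftrightarrow> (\<forall>j. psum j v \<le> psum j w \<and> psum j w \<le> psum j v + 1)"

definition alcove_chain :: "int \<Rightarrow> (real ^ 'n::{finite,linorder}) set \<Rightarrow> bool" where
  "alcove_chain k D \<longleftrightarrow>
     D \<subseteq> lattice_points (sum_hyperplane k) \<and> (\<forall>v\<in>D. \<forall>w\<in>D. near v w \<or> near w v)"

definition cell :: "real ^ 'n::{finite,linorder} \<Rightarrow> (real, 'n) vec \<Rightarrow> real set" where
  "cell x v = {t \<in> {0..<1}. \<forall>j. of_int \<lfloor>psum j x + t\<rfloor> = psum j v}"

definition weight :: "real ^ 'n::{finite,linorder} \<Rightarrow> (real, 'n) vec \<Rightarrow> real" where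
  "weight x v = measure lborel (cell x v)"

lemma psum_lattice: "v \<in> lattice_points S \<Longrightarrow> psum j v \<in> \<int>"
  by (simp add: lattice_points_def psum_Ints)

lemma alcove_chain_subset: "alcove_chain k D \<Longrightarrow> C \<subseteq> D \<Longrightarrow> alcove_chain k C"
  unfolding alcove_chain_def by blast

text \<open>For integral \<open>psum j v\<close> the floor condition says that \<open>t\<close> lies
  in a half-open unit interval. The cell is thus a countable intersection of intervals, which gives
  measurability.\<close>

lemma cell_eq_Int:
  assumes "v \<in> lattice_points S"
  shows "cell x v = {0..<1} \<inter> (\<Inter>j. {psum j v - psum j x ..< psum j v - psum j x + 1})"
proof -
  have "of_int \<lfloor>psum j x + t\<rfloor> = psum j v \<longleftrightarrow> t \<in> {psum j v - psum j x ..< psum j v - psum j x + 1}" for j t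
  proof -
    obtain a where "psum j v = of_int a"
      using psum_lattice[OF assms] by (meson Ints_cases)
    then show ?thesis
      by (simp add: floor_eq_iff) linarith
  qed
  then show ?thesis
    unfolding cell_def by auto
qed

lemma cell_measurable:
  assumes "v \<in> lattice_points S"
  shows "cell x v \<in> sets lborel"
  unfolding cell_eq_Int[OF assms] by auto

lemma cell_subset: "cell x v \<subseteq> {0..<1}"
  unfolding cell_def by blast

lemma cell_fmeasurable:
  assumes "v \<in> lattice_points S"
  shows "cell x v \<in> fmeasurable lborel"
  using cell_subset cell_measurable[OF assms]
  by (rule fmeasurableI2[rotated]) (auto simp: fmeasurable_def)

lemma cell_disjoint: "v \<noteq> w \<Longrightarrow> cell x v \<inter> cell x w = {}"
  unfolding cell_def using psum_eqI[of v w] by auto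

lemma sum_weight:
  assumes "finite F" "F \<subseteq> lattice_points S"
  shows "(\<Sum>v\<in>F. weight x v) = measure lborel (\<Union>v\<in>F. cell x v)"
  unfolding weight_def
proof (rule measure_finite_Union[symmetric])
  show "disjoint_family_on (cell x) F"
    by (auto simp: disjoint_family_on_def dest: cell_disjoint)
  show "emeasure lborel (cell x v) \<noteq> \<infinity>" if "v \<in> F" for v
    using cell_fmeasurable[of v S x] that assms by (auto simp: fmeasurable_def)
qed (use assms cell_measurable in auto)

text \<open>The cells are disjoint pieces of an interval of length one. This bound later turns the
  inequality for the coefficients into an equality.\<close>

lemma sum_weight_le_1:
  assumes "finite F" "F \<subseteq> lattice_points S"
  shows "(\<Sum>v\<in>F. weight x v) \<le> 1"
proof -
  have "measure lborel (\<Union>v\<in>F. cell x v) \<le> measure lborel {0..<1::real}"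
  proof (rule measure_mono_fmeasurable)
    show "(\<Union>v\<in>F. cell x v) \<subseteq> {0..<1}"
      using cell_subset by blast
    show "(\<Union>v\<in>F. cell x v) \<in> sets lborel"
      using assms cell_measurable by (intro sets.finite_UN) blast+
    show "{0..<1::real} \<in> fmeasurable lborel"
      by (simp add: fmeasurable_def)
  qed
  then show ?thesis
    by (simp add: sum_weight[OF assms])
qed

lemma weight_nonneg: "0 \<le> weight x v"
  by (simp add: weight_def)

text \<open>The times at which \<open>x\<close> rounds to \<open>v\<close> form an interval of length at least the barycentric
  coordinate of \<open>v\<close>: it starts at the total weight of the chain elements below \<open>v\<close>.\<close>

lemma chain_coefficient_le_weight:
  fixes x :: "real ^ 'n::{finite,linorder}"
  assumes C: "alcove_chain k C" "finite C"
    and u: "\<And>v. v \<in> C \<Longrightarrow> 0 \<le> u v" "sum u C = 1" and x: "x = (\<Sum>v\<in>C. u v *\<^sub>R v)"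
    and v: "v \<in> C"
  shows "u v \<le> weight x v"
proof -
  have lat: "v \<in> lattice_points (sum_hyperplane k)"
    using C v by (auto simp: alcove_chain_def)
  \<comment> \<open>The elements strictly below \<open>v\<close>; \<open>s\<close> is their total
    coefficient and becomes the starting time of the interval.\<close>
  define B where "B = {w \<in> C. w \<noteq> v \<and> near w v}"
  define s where "s = sum u B"
  have B: "B \<subseteq> C" "v \<notin> B" "finite B"
    using C by (auto simp: B_def)
  have s0: "0 \<le> s"
    unfolding s_def using B u by (intro sum_nonneg) auto
  have sv: "s + u v = sum u (insert v B)"
    unfolding s_def using B by simp
  have s1: "s + u v \<le> 1"
    unfolding sv u(2)[symmetric] using B v C u by (intro sum_mono2) auto
  have "of_int \<lfloor>psum j x + t\<rfloor> = psum j v" if t: "s \<le> t" "t < s + u v" for t j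
  proof -
    obtain a where a: "psum j v = of_int a"
      using psum_lattice[OF lat] by (meson Ints_cases)
    have dev: "psum j x - a = (\<Sum>w\<in>C. u w * (psum j w - a))"
      using u(2) by (simp add: x psum_sum right_diff_distrib sum_subtractf flip: sum_distrib_right)
    have int: "psum j w \<in> \<int>" if "w \<in> C" for w
      using C that psum_lattice unfolding alcove_chain_def by blast
    have nr: "near w v \<or> near v w" "near w w' \<or> near w' w" if "w \<in> C" "w' \<in> C" for w w'
      using C v that unfolding alcove_chain_def by blast+
    \<comment> \<open>Two chain elements differ by at most one in the \<open>j\<close>-th sum, and
      these sums are integers. So they take either values in \<open>{a - 1, a}\<close> or values in
      \<open>{a, a + 1}\<close>. In the first case only elements below \<open>v\<close> deviate from
      \<open>a\<close>, which gives a deviation between \<open>- s\<close> and 0.\<close>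
    show ?thesis
    proof (cases "\<exists>w\<in>C. psum j w < a")
      case True
      then obtain w0 where w0: "w0 \<in> C" "psum j w0 < a" by blast
      have up: "psum j w \<le> a" if w: "w \<in> C" for w
      proof -
        have "psum j w \<le> psum j w0 + 1"
          using nr(2)[OF w w0(1)] by (smt (verit) near_def)
        then have "psum j w < a + 1" using w0 by simp
        moreover obtain b where "psum j w = of_int b"
          using int[OF w] by (meson Ints_cases)
        ultimately show ?thesis by simp
      qed
      have "(\<Sum>w\<in>C. u w * (psum j w - a)) = (\<Sum>w\<in>B. u w * (psum j w - a))"
      proof (rule sum.mono_neutral_right)
        show "\<forall>w\<in>C - B. u w * (psum j w - a) = 0"
        proof
          fix w assume w: "w \<in> C - B"
          then have "w = v \<or> near v w"
            using nr(1)[of w] unfolding B_def by blast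
          then have "psum j w = a"
            using up[of w] w a by (metis DiffD1 antisym near_def)
          then show "u w * (psum j w - a) = 0" by simp
        qed
      qed (use C B in auto)
      also have "\<dots> \<ge> (\<Sum>w\<in>B. - u w)"
      proof (rule sum_mono)
        fix w assume w: "w \<in> B"
        then have "psum j w - a \<ge> -1"
          using a unfolding B_def near_def by (smt (verit) mem_Collect_eq)
        then have "u w * (psum j w - a) \<ge> u w * (-1)"
          using w B u(1)[of w] by (intro mult_left_mono) auto
        then show "- u w \<le> u w * (psum j w - a)" by simp
      qed
      finally have "psum j x - a \<ge> - s"
        using dev by (simp add: s_def sum_negf)
      moreover have "(\<Sum>w\<in>C. u w * (psum j w - a)) \<le> 0"
        using up u by (intro sum_nonpos) (simp add: mult_nonneg_nonpos)
      ultimately have "\<lfloor>psum j x + t\<rfloor> = a"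
        using dev t s1 by (simp add: floor_eq_iff)
      then show ?thesis by (simp add: a)
    next
      \<comment> \<open>Now only elements above \<open>v\<close> deviate from \<open>a\<close>.
        Their total coefficient is \<open>1 - (s + u v)\<close>, so the deviation lies between 0 and
        that number.\<close>
      case False
      have "(\<Sum>w\<in>C. u w * (psum j w - a)) = (\<Sum>w\<in>C - insert v B. u w * (psum j w - a))"
      proof (rule sum.mono_neutral_right)
        show "\<forall>w\<in>C - (C - insert v B). u w * (psum j w - a) = 0"
        proof
          fix w assume w: "w \<in> C - (C - insert v B)"
          then have "w = v \<or> near w v"
            unfolding B_def by blast
          then have "psum j w = a"
            using False w a by (metis Diff_iff antisym linorder_not_less near_def)
          then show "u w * (psum j w - a) = 0" by simp
        qed
      qed (use C in auto)
      also have "\<dots> \<le> (\<Sum>w\<in>C - insert v B. u w)"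
      proof (rule sum_mono)
        fix w assume w: "w \<in> C - insert v B"
        then have "near v w"
          using nr(1)[of w] unfolding B_def by blast
        then have "psum j w - a \<le> 1"
          using a unfolding near_def by (smt (verit))
        then have "u w * (psum j w - a) \<le> u w * 1"
          using w u(1)[of w] by (intro mult_left_mono) auto
        then show "u w * (psum j w - a) \<le> u w" by simp
      qed
      also have "\<dots> = 1 - (s + u v)"
        unfolding sv u(2)[symmetric] using B v C by (intro sum_diff) auto
      finally have "psum j x - a \<le> 1 - (s + u v)"
        using dev by simp
      moreover have "(\<Sum>w\<in>C. u w * (psum j w - a)) \<ge> 0"
        using False u by (intro sum_nonneg) (force simp: not_less)
      ultimately have "\<lfloor>psum j x + t\<rfloor> = a"
        using dev t s0 by (simp add: floor_eq_iff)
      then show ?thesis by (simp add: a)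
    qed
  qed
  then have "{s..<s + u v} \<subseteq> cell x v"
    unfolding cell_def using s0 s1 by auto
  then have "measure lborel {s..<s + u v} \<le> weight x v"
    unfolding weight_def using cell_fmeasurable[OF lat]
    by (intro measure_mono_fmeasurable) auto
  then show ?thesis
    using u(1)[OF v] by simp
qed

text \<open>Termwise \<open>u\<close> is at most the weight, while \<open>u\<close> sums to one and
  the weights sum to at most one; hence equality in every term. The weights on \<open>C\<close> then
  use up the whole unit interval and leave nothing for another lattice point.\<close>

lemma chain_weights:
  fixes x :: "real ^ 'n::{finite,linorder}"
  assumes C: "alcove_chain k C" "finite C"
    and u: "\<And>v. v \<in> C \<Longrightarrow> 0 \<le> u v" "sum u C = 1" and x: "x = (\<Sum>v\<in>C. u v *\<^sub>R v)"
  shows "v \<in> C \<Longrightarrow> u v = weight x v"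
    and "v \<in> lattice_points S \<Longrightarrow> v \<notin> C \<Longrightarrow> weight x v = 0"
proof -
  have lat: "C \<subseteq> lattice_points UNIV"
    using C by (auto simp: alcove_chain_def lattice_points_def)
  have le: "u v \<le> weight x v" if "v \<in> C" for v
    using chain_coefficient_le_weight[OF C u x that] by blast
  have "sum (weight x) C \<le> sum u C"
    using sum_weight_le_1[OF C(2) lat] u by simp
  then have eq: "u v = weight x v" if "v \<in> C" for v
    using sum_mono_inv[of u C "weight x" v] le that C(2) sum_mono[of C u "weight x"] by fastforce
  then show "v \<in> C \<Longrightarrow> u v = weight x v" .
  assume v: "v \<in> lattice_points S" "v \<notin> C"
  have "sum (weight x) (insert v C) \<le> 1"
    using C(2) lat v by (intro sum_weight_le_1[where S=UNIV]) (auto simp: lattice_points_def)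
  moreover have "sum (weight x) C = 1"
    using u(2) eq by (metis sum.cong)
  ultimately show "weight x v = 0"
    using v C(2) weight_nonneg[of x v] by simp
qed

text \<open>Relative to one fixed element, each of the \<open>n\<close> first partial sums has at
  most three possible values, and these sums determine a lattice point of the hyperplane.\<close>

lemma finite_alcove_chain:
  fixes C :: "(real ^ 'n::{finite,linorder}) set"
  assumes C: "alcove_chain k C"
  shows "finite C"
proof (cases "C = {}")
  case False
  then obtain v where v: "v \<in> C" by blast
  let ?f = "\<lambda>w. restrict (\<lambda>j. \<lfloor>psum j w\<rfloor>) {..<CARD('n)}"
  have "?f ` C \<subseteq> (\<Pi>\<^sub>E j\<in>{..<CARD('n)}. {\<lfloor>psum j v\<rfloor> - 1..\<lfloor>psum j v\<rfloor> + 1})"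
  proof clarify
    fix w assume "w \<in> C"
    then have "near v w \<or> near w v"
      using C v unfolding alcove_chain_def by blast
    then have "psum j v - 1 \<le> psum j w \<and> psum j w \<le> psum j v + 1" for j
      unfolding near_def by (smt (verit))
    then have "\<lfloor>psum j w\<rfloor> \<in> {\<lfloor>psum j v\<rfloor> - 1..\<lfloor>psum j v\<rfloor> + 1}" for j
      using floor_mono[of "psum j v - 1" "psum j w"] floor_mono[of "psum j w" "psum j v + 1"] by simp
    then show "?f w \<in> (\<Pi>\<^sub>E j\<in>{..<CARD('n)}. {\<lfloor>psum j v\<rfloor> - 1..\<lfloor>psum j v\<rfloor> + 1})"
      by auto
  qed
  then have "finite (?f ` C)"
    by (rule finite_subset) (auto intro!: finite_PiE)
  moreover have "inj_on ?f C"
  proof (rule inj_onI)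
    fix w w' assume w: "w \<in> C" "w' \<in> C" "?f w = ?f w'"
    show "w = w'"
    proof (rule psum_eqI)
      fix j
      show "psum j w = psum j w'"
      proof (cases "j < CARD('n)")
        case True
        then have "\<lfloor>psum j w\<rfloor> = \<lfloor>psum j w'\<rfloor>"
          using w(3) by (metis lessThan_iff restrict_apply')
        moreover have "psum j w \<in> \<int>" "psum j w' \<in> \<int>"
          using w C psum_lattice unfolding alcove_chain_def by blast+
        ultimately show ?thesis
          by (metis floor_of_int Ints_cases)
      next
        case False
        moreover have "w \<in> sum_hyperplane k" "w' \<in> sum_hyperplane k"
          using w C unfolding alcove_chain_def lattice_points_def by auto
        ultimately show ?thesis
          using psum_hyperplane_ge[of w k j] psum_hyperplane_ge[of w' k j] by simp
      qed
    qed
  qed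
  ultimately show ?thesis
    by (simp add: finite_image_iff)
qed simp

lemma mem_chain_hull:
  assumes C: "alcove_chain k C" and x: "x \<in> convex hull C"
  shows "sum (weight x) C = 1" "x = (\<Sum>v\<in>C. weight x v *\<^sub>R v)"
    and "v \<in> lattice_points S \<Longrightarrow> v \<notin> C \<Longrightarrow> weight x v = 0"
proof -
  have fin: "finite C" using C by (rule finite_alcove_chain)
  obtain u where u: "\<And>v. v \<in> C \<Longrightarrow> 0 \<le> u v" "sum u C = 1" and xu: "x = (\<Sum>v\<in>C. u v *\<^sub>R v)"
    using x fin by (auto simp: convex_hull_finite)
  note w = chain_weights[OF C fin u xu]
  show "sum (weight x) C = 1" "x = (\<Sum>v\<in>C. weight x v *\<^sub>R v)"
    using u(2) xu w(1) by (metis (mono_tags, lifting) sum.cong)+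
  show "v \<in> lattice_points S \<Longrightarrow> v \<notin> C \<Longrightarrow> weight x v = 0"
    by (rule w(2))
qed

text \<open>The weights of a common point vanish outside \<open>C\<close> and outside
  \<open>D\<close>, so the same weights represent it over \<open>C \<inter> D\<close>.\<close>

lemma chain_hull_Int:
  assumes C: "alcove_chain k C" and D: "alcove_chain k D"
  shows "convex hull C \<inter> convex hull D = convex hull (C \<inter> D)"
proof (intro equalityI subsetI)
  fix x assume x: "x \<in> convex hull C \<inter> convex hull D"
  have fin: "finite C" using C by (rule finite_alcove_chain)
  note wC = mem_chain_hull[OF C, of x] and wD = mem_chain_hull[OF D, of x]
  have z: "weight x v = 0" if "v \<in> C - C \<inter> D" for v
    using wD(3)[of v] that x C unfolding alcove_chain_def by blast
  have "sum (weight x) (C \<inter> D) = sum (weight x) C"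
    using z fin by (intro sum.mono_neutral_left) auto
  moreover have "(\<Sum>v\<in>C \<inter> D. weight x v *\<^sub>R v) = (\<Sum>v\<in>C. weight x v *\<^sub>R v)"
    using z fin by (intro sum.mono_neutral_left) auto
  ultimately show "x \<in> convex hull (C \<inter> D)"
    using wC x fin weight_nonneg by (auto simp: convex_hull_finite intro!: exI[of _ "weight x"])
next
  fix x assume "x \<in> convex hull (C \<inter> D)"
  then show "x \<in> convex hull C \<inter> convex hull D"
    by (meson IntI Int_lower1 Int_lower2 hull_mono subsetD)
qed

text \<open>An affine dependence \<open>U\<close> would give the barycenter two different systems of
  nonnegative coefficients, the constant one and a small perturbation of it along \<open>U\<close>.
  But the coefficients are the weights.\<close>

lemma alcove_chain_independent:
  assumes C: "alcove_chain k C"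
  shows "\<not> affine_dependent C"
proof
  assume dep: "affine_dependent C"
  have fin: "finite C" using C by (rule finite_alcove_chain)
  obtain U v where U: "sum U C = 0" "v \<in> C" "U v \<noteq> 0" "(\<Sum>v\<in>C. U v *\<^sub>R v) = 0"
    using dep fin by (auto simp: affine_dependent_explicit_finite)
  define N where "N = real (card C)"
  have N: "N > 0" using U fin by (auto simp: N_def card_gt_0_iff)
  define M where "M = (\<Sum>w\<in>C. \<bar>U w\<bar>)"
  have M: "\<bar>U w\<bar> \<le> M" if "w \<in> C" for w
    unfolding M_def using fin that by (intro member_le_sum) auto
  have Mpos: "M > 0" using M[OF U(2)] U(3) by linarith
  \<comment> \<open>Small enough that the perturbation never exceeds \<open>1 / N\<close> in
    absolute value, so the coefficients stay nonnegative.\<close>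
  define e where "e = 1 / (N * M)"
  have e: "e > 0" using N Mpos by (simp add: e_def)
  let ?x = "\<Sum>w\<in>C. (1 / N) *\<^sub>R w"
  have "1 / N = weight ?x v"
    using N U(2) by (intro chain_weights(1)[OF C fin, where u="\<lambda>_. 1 / N"]) (auto simp: N_def)
  moreover have "1 / N + e * U v = weight ?x v"
  proof (rule chain_weights(1)[OF C fin, where u="\<lambda>w. 1 / N + e * U w"])
    fix w assume "w \<in> C"
    then have "e * \<bar>U w\<bar> \<le> e * M"
      using M e by (intro mult_left_mono) auto
    also have "\<dots> = 1 / N" using Mpos by (simp add: e_def)
    finally have "\<bar>e * U w\<bar> \<le> 1 / N"
      using e by (simp add: abs_mult)
    then show "0 \<le> 1 / N + e * U w" by linarith
  next
    show "(\<Sum>w\<in>C. 1 / N + e * U w) = 1"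
      using U N by (simp add: sum.distrib N_def flip: sum_distrib_left)
    have "(\<Sum>w\<in>C. (e * U w) *\<^sub>R w) = e *\<^sub>R (\<Sum>w\<in>C. U w *\<^sub>R w)"
      by (simp add: scaleR_sum_right)
    then show "?x = (\<Sum>w\<in>C. (1 / N + e * U w) *\<^sub>R w)"
      using U by (simp add: scaleR_left_distrib sum.distrib)
  qed (use U in auto)
  ultimately show False
    using e U by simp
qed

text \<open>A single vertex is itself a chain, so its intersection with the hull of \<open>D\<close>
  is the hull of \<open>{v} \<inter> D\<close>, which must not be empty.\<close>

lemma chain_subset_if_hull_subset:
  assumes C: "alcove_chain k C" and D: "alcove_chain k D" and sub: "C \<subseteq> convex hull D"
  shows "C \<subseteq> D"
proof
  fix v assume v: "v \<in> C"
  have "alcove_chain k {v}"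
    using C v by (auto intro: alcove_chain_subset)
  then have "convex hull {v} \<inter> convex hull D = convex hull ({v} \<inter> D)"
    using D by (rule chain_hull_Int)
  moreover have "v \<in> convex hull {v} \<inter> convex hull D"
    using sub v by auto
  ultimately have "convex hull ({v} \<inter> D) \<noteq> {}"
    by blast
  then show "v \<in> D" by (auto simp del: convex_hull_singleton)
qed

text \<open>At the barycenter every vertex of \<open>C\<close> has positive weight, whereas weights
  vanish outside \<open>D\<close>. Covering this one point therefore places all of \<open>C\<close>
  inside a full chain.\<close>

lemma chain_barycenter_mem:
  assumes C: "alcove_chain k C" and D: "alcove_chain k D" and "C \<noteq> {}"
    and mem: "(\<Sum>v\<in>C. (1 / real (card C)) *\<^sub>R v) \<in> convex hull D" (is "?x \<in> _")
  shows "C \<subseteq> D"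
proof
  fix v assume v: "v \<in> C"
  have fin: "finite C" using C by (rule finite_alcove_chain)
  have "1 / real (card C) = weight ?x v"
    using fin assms(3) v
    by (intro chain_weights(1)[OF C fin, where u="\<lambda>_. 1 / real (card C)"]) auto
  moreover have "v \<in> lattice_points (sum_hyperplane k)"
    using C v unfolding alcove_chain_def by blast
  ultimately show "v \<in> D"
    using mem_chain_hull(3)[OF D mem, of v] fin v by fastforce
qed

section \<open>Rounding a point of the hyperplane to its chain of lattice points\<close>

definition round_at :: "real \<Rightarrow> real ^ 'n::{finite,linorder} \<Rightarrow> (real, 'n) vec" where
  "round_at t x = of_psums (\<lambda>j. of_int \<lfloor>psum j x + t\<rfloor>)"

text \<open>The range \<open>0 \<le> t < 1\<close> matters at both ends: \<open>of_psums\<close>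
  subtracts its value at 0, which is the floor of \<open>t\<close>, hence 0, and the total
  \<open>k\<close> is an integer that rounding does not change.\<close>

lemma psum_round_at:
  fixes x :: "real ^ 'n::{finite,linorder}"
  assumes "x \<in> sum_hyperplane k" "0 \<le> t" "t < 1"
  shows "psum j (round_at t x) = of_int \<lfloor>psum j x + t\<rfloor>"
proof -
  have *: "psum j (round_at t x) = of_int \<lfloor>psum j x + t\<rfloor>" if "j \<le> CARD('n)" for j
    using assms that by (simp add: round_at_def psum_of_psums floor_eq_iff)
  show ?thesis
  proof (cases "j \<le> CARD('n)")
    case False
    then show ?thesis
      using *[of "CARD('n)"] psum_ge_CARD[of j x] psum_ge_CARD[of j "round_at t x"]
        psum_ge_CARD[of "CARD('n)" x] psum_ge_CARD[of "CARD('n)" "round_at t x"] by simp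
  qed (rule *)
qed

lemma round_at_lattice:
  assumes "x \<in> sum_hyperplane k" "0 \<le> t" "t < 1"
  shows "round_at t x \<in> lattice_points (sum_hyperplane k)"
proof -
  have "round_at t x \<in> sum_hyperplane k"
    using assms by (simp add: mem_sum_hyperplane psum_round_at floor_eq_iff)
  moreover have "round_at t x $ i \<in> \<int>" for i
    by (rule Ints_of_psum) (simp add: psum_round_at[OF assms])
  ultimately show ?thesis by (simp add: lattice_points_def)
qed

text \<open>Floor is monotone and commutes with adding the integer \<open>c\<close>. Since
  \<open>i\<close> and \<open>j\<close> are in any order, lower bounds are covered too.\<close>

lemma round_at_gap_le:
  assumes x: "x \<in> sum_hyperplane k" "0 \<le> t" "t < 1" and "psum j x - psum i x \<le> of_int c"
  shows "psum j (round_at t x) - psum i (round_at t x) \<le> of_int c"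
proof -
  have "\<lfloor>psum j x + t\<rfloor> \<le> \<lfloor>psum i x + t + of_int c\<rfloor>"
    using assms by (intro floor_mono) simp
  then have "\<lfloor>psum j x + t\<rfloor> \<le> \<lfloor>psum i x + t\<rfloor> + c"
    by simp
  then show ?thesis
    unfolding psum_round_at[OF x] by linarith
qed

lemma alcove_chain_round_at:
  assumes x: "x \<in> sum_hyperplane k"
  shows "alcove_chain k ((\<lambda>t. round_at t x) ` {0..<1})"
  unfolding alcove_chain_def
proof (intro conjI ballI)
  show "(\<lambda>t. round_at t x) ` {0..<1} \<subseteq> lattice_points (sum_hyperplane k)"
    using round_at_lattice[OF x] by auto
  have le: "near (round_at s x) (round_at t x)" if "0 \<le> s" "s \<le> t" "t < 1" for s t
    unfolding near_def
  proof
    fix j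
    have "\<lfloor>psum j x + s\<rfloor> \<le> \<lfloor>psum j x + t\<rfloor>"
      using that by (intro floor_mono) auto
    moreover have "\<lfloor>psum j x + t\<rfloor> \<le> \<lfloor>psum j x + s + 1\<rfloor>"
      using that by (intro floor_mono) auto
    ultimately show "psum j (round_at s x) \<le> psum j (round_at t x) \<and>
        psum j (round_at t x) \<le> psum j (round_at s x) + 1"
      using that by (simp add: psum_round_at[OF x])
  qed
  fix v w assume "v \<in> (\<lambda>t. round_at t x) ` {0..<1}" "w \<in> (\<lambda>t. round_at t x) ` {0..<1}"
  then obtain s t where "s \<in> {0..<1}" "t \<in> {0..<1}" "v = round_at s x" "w = round_at t x"
    by blast
  then show "near v w \<or> near w v"
    using le[of s t] le[of t s] by fastforce
qed

text \<open>The cells of the roundings partition the unit interval, so the weights sum to one. For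
  fixed \<open>j\<close> the rounded sum is \<open>f + 1\<close> during a time equal to the
  fractional part of \<open>psum j x\<close> and \<open>f\<close> otherwise, so its average is
  \<open>psum j x\<close>.\<close>

lemma mem_hull_round_at:
  fixes x :: "real ^ 'n::{finite,linorder}"
  assumes x: "x \<in> sum_hyperplane k"
  shows "x \<in> convex hull ((\<lambda>t. round_at t x) ` {0..<1})" (is "x \<in> convex hull ?R")
proof -
  have fin: "finite ?R"
    by (rule finite_alcove_chain[OF alcove_chain_round_at[OF x]])
  have lat: "?R \<subseteq> lattice_points (sum_hyperplane k)"
    using alcove_chain_round_at[OF x] by (simp add: alcove_chain_def)
  have cell: "t \<in> cell x v \<longleftrightarrow> t \<in> {0..<1} \<and> v = round_at t x" for t v
  proof (cases "t \<in> {0..<1}")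
    case True
    then have "psum j (round_at t x) = of_int \<lfloor>psum j x + t\<rfloor>" for j
      using psum_round_at[OF x] by simp
    then have "v = round_at t x \<longleftrightarrow> (\<forall>j. of_int \<lfloor>psum j x + t\<rfloor> = psum j v)"
      by (metis psum_eqI)
    then show ?thesis
      using True by (simp add: cell_def)
  qed (auto simp: cell_def)
  have U: "(\<Union>v\<in>?R. cell x v) = {0..<1}"
    using cell by auto
  then have one: "sum (weight x) ?R = 1"
    using sum_weight[OF fin lat, of x] by simp
  have "psum j (\<Sum>v\<in>?R. weight x v *\<^sub>R v) = psum j x" for j
  proof -
    define f where "f = \<lfloor>psum j x\<rfloor>"
    have val: "psum j v = (if v \<in> {v \<in> ?R. psum j v = f + 1} then f + 1 else f)" if v: "v \<in> ?R" for v
    proof -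
      obtain t where t: "t \<in> {0..<1}" "v = round_at t x" using v by blast
      have "\<lfloor>psum j x + t\<rfloor> = f \<or> \<lfloor>psum j x + t\<rfloor> = f + 1"
        using t unfolding f_def by (simp add: floor_eq_iff) linarith
      then show ?thesis
        using v t psum_round_at[OF x, of t j] by auto
    qed
    have "(\<Union>v\<in>{v \<in> ?R. psum j v = f + 1}. cell x v) = {1 - (psum j x - f)..<1}" (is "?L = ?I")
    proof -
      have "t \<in> ?L \<longleftrightarrow> t \<in> {0..<1} \<and> \<lfloor>psum j x + t\<rfloor> = f + 1" for t
        using cell psum_round_at[OF x, of t j] by auto
      also have "\<dots> t \<longleftrightarrow> t \<in> ?I" for t
        unfolding f_def by (auto simp: floor_eq_iff) linarith+
      finally show ?thesis by (rule set_eqI)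
    qed
    then have "sum (weight x) {v \<in> ?R. psum j v = f + 1} = measure lborel {1 - (psum j x - f)..<1}"
      using fin lat by (subst sum_weight[where S="sum_hyperplane k"]) auto
    then have frac: "sum (weight x) {v \<in> ?R. psum j v = f + 1} = psum j x - f"
      by (simp add: f_def)
    have "psum j (\<Sum>v\<in>?R. weight x v *\<^sub>R v) = (\<Sum>v\<in>?R. weight x v * psum j v)"
      by (simp add: psum_sum)
    also have "\<dots> = (\<Sum>v\<in>?R. weight x v * f + (if v \<in> {v \<in> ?R. psum j v = f + 1} then weight x v else 0))"
    proof (rule sum.cong)
      fix v assume "v \<in> ?R"
      from val[OF this] \<open>v \<in> ?R\<close>
      show "weight x v * psum j v =
          weight x v * f + (if v \<in> {v \<in> ?R. psum j v = f + 1} then weight x v else 0)"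
        by (cases "psum j v = f + 1") (simp_all add: algebra_simps)
    qed simp
    also have "\<dots> = sum (weight x) ?R * f + sum (weight x) {v \<in> ?R. psum j v = f + 1}"
      using fin by (simp add: sum.distrib sum_distrib_right sum.inter_filter)
    also have "\<dots> = psum j x"
      using one frac by simp
    finally show ?thesis .
  qed
  then have "(\<Sum>v\<in>?R. weight x v *\<^sub>R v) = x"
    by (rule psum_eqI)
  then show ?thesis
    using fin one weight_nonneg by (auto simp: convex_hull_finite intro!: exI[of _ "weight x"])
qed

subsection \<open>Alcoves\<close>

text \<open>Removing one closed set of smaller dimension leaves a relatively open dense subset of
  \<open>S\<close>, and Baire's theorem allows countably many removals. Countability is used for the
  infinitely many walls; the other applications remove finitely many simplices.\<close>

lemma dense_Diff_lower_dim:
  fixes S :: "'a::euclidean_space set"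
  assumes "convex S" "closed S" "countable \<F>"
    and \<F>: "\<And>F. F \<in> \<F> \<Longrightarrow> closed F" "\<And>F. F \<in> \<F> \<Longrightarrow> aff_dim (S \<inter> F) < aff_dim S"
  shows "S \<subseteq> closure (S - \<Union>\<F>)"
proof -
  let ?\<G> = "insert S ((\<lambda>F. S - F) ` \<F>)"
  have "S \<subseteq> closure (\<Inter>?\<G>)"
  proof (rule Baire)
    fix T assume "T \<in> ?\<G>"
    then consider "T = S" | F where "F \<in> \<F>" "T = S - F" by blast
    then show "openin (top_of_set S) T \<and> S \<subseteq> closure T"
    proof cases
      case 2
      have "closure (S - S \<inter> F) = S"
        using \<F>(2)[OF 2(1)] assms(1,2) by (rule dense_complement_convex_closed)
      then have "S \<subseteq> closure T"
        using 2 by (simp add: Diff_Int)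
      moreover have "openin (top_of_set S) (S - F)"
        using \<F>(1)[OF 2(1)] by (metis Diff_Int_distrib Diff_eq open_Compl openin_open_Int)
      ultimately show ?thesis using 2 by simp
    qed (use closure_subset in auto)
  qed (use assms in auto)
  moreover have "\<Inter>?\<G> = S - \<Union>\<F>" by auto
  ultimately show ?thesis by simp
qed

definition full_chains :: "int \<Rightarrow> (real ^ 'n::{finite,linorder}) set \<Rightarrow> (real ^ 'n::{finite,linorder}) set set" where
  "full_chains k P = {D. alcove_chain k D \<and> D \<subseteq> P \<and> card D = CARD('n)}"

text \<open>The common form to which alcoves, sorted simplices and circuit simplices are
  reduced.\<close>

definition chain_simplices :: "int \<Rightarrow> (real ^ 'n::{finite,linorder}) set \<Rightarrow> (real ^ 'n::{finite,linorder}) set set" where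
  "chain_simplices k P = (\<lambda>D. convex hull D) ` full_chains k P"

lemma convex_sum_hyperplane: "convex (sum_hyperplane k :: (real ^ 'n::{finite,linorder}) set)"
  by (simp add: affine_sum_hyperplane affine_imp_convex)

lemma closed_sum_hyperplane: "closed (sum_hyperplane k :: (real ^ 'n::{finite,linorder}) set)"
  by (simp add: sum_hyperplane_eq_inner closed_hyperplane)

lemma alcove_chain_subset_hyperplane: "alcove_chain k D \<Longrightarrow> D \<subseteq> sum_hyperplane k"
  unfolding alcove_chain_def lattice_points_def by blast

lemma hull_alcove_chain_subset:
  "alcove_chain k D \<Longrightarrow> convex hull D \<subseteq> sum_hyperplane k"
  by (simp add: alcove_chain_subset_hyperplane convex_sum_hyperplane hull_minimal)

lemma aff_dim_alcove_chain:
  "alcove_chain k D \<Longrightarrow> aff_dim (convex hull D) = int (card D) - 1"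
  using aff_dim_affine_independent[OF alcove_chain_independent[of k D]]
  by (simp add: aff_dim_convex_hull)

lemma card_alcove_chain_le:
  fixes D :: "(real ^ 'n::{finite,linorder}) set"
  assumes D: "alcove_chain k D"
  shows "card D \<le> CARD('n)"
  using aff_dim_subset[OF hull_alcove_chain_subset[OF D]] aff_dim_alcove_chain[OF D]
  by (simp add: aff_dim_sum_hyperplane)

lemma closed_chain_hull: "alcove_chain k D \<Longrightarrow> closed (convex hull D)"
  by (simp add: compact_imp_closed finite_alcove_chain finite_imp_compact_convex_hull)

lemma affine_hull_full_chain:
  fixes D :: "(real ^ 'n::{finite,linorder}) set"
  assumes "alcove_chain k D" "card D = CARD('n)"
  shows "affine hull (convex hull D) = sum_hyperplane k"
proof -
  have "aff_dim (convex hull D) = aff_dim (sum_hyperplane k :: (real, 'n) vec set)"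
    using assms by (simp only: aff_dim_alcove_chain aff_dim_sum_hyperplane)
  moreover have "affine hull (convex hull D) \<subseteq> sum_hyperplane k"
    using hull_alcove_chain_subset[OF assms(1)] affine_sum_hyperplane by (rule hull_minimal)
  moreover have "affine hull (convex hull D) \<noteq> {}"
    using assms(2) by auto
  ultimately show ?thesis
    using affine_dim_equal[of "affine hull (convex hull D)" "sum_hyperplane k"]
    by (simp only: affine_sum_hyperplane affine_affine_hull aff_dim_affine_hull simp_thms True_implies_equals)
qed

section \<open>Alcoves described by the integer parts of the gaps of a point\<close>

definition open_alcove :: "int \<Rightarrow> real ^ 'n::{finite,linorder} \<Rightarrow> (real ^ 'n::{finite,linorder}) set" where
  "open_alcove k x = {z \<in> sum_hyperplane k. \<forall>i j. i < j \<and> j < CARD('n) \<longrightarrow>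
     of_int \<lfloor>psum j x - psum i x\<rfloor> < psum j z - psum i z \<and>
     psum j z - psum i z < of_int \<lfloor>psum j x - psum i x\<rfloor> + 1}"

text \<open>Naming an alcove by a point \<open>x\<close> avoids tables of integers, most of which
  would describe empty sets: the floors of the gaps of a regular \<open>x\<close> are always
  consistent.\<close>

definition closed_alcove :: "int \<Rightarrow> real ^ 'n::{finite,linorder} \<Rightarrow> (real ^ 'n::{finite,linorder}) set" where
  "closed_alcove k x = {z \<in> sum_hyperplane k. \<forall>i j. i < j \<and> j < CARD('n) \<longrightarrow>
     of_int \<lfloor>psum j x - psum i x\<rfloor> \<le> psum j z - psum i z \<and>
     psum j z - psum i z \<le> of_int \<lfloor>psum j x - psum i x\<rfloor> + 1}"

definition regular_points :: "int \<Rightarrow> (real ^ 'n::{finite,linorder}) set" where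
  "regular_points k = sum_hyperplane k - \<Union>alcove_hyperplanes"

lemma regular_point_gap:
  fixes x :: "real ^ 'n::{finite,linorder}"
  assumes "x \<in> regular_points k" "i < j" "j < CARD('n)"
  shows "psum j x - psum i x \<notin> \<int>"
  using assms unfolding regular_points_def Union_alcove_hyperplanes by blast

lemma regular_point_mem_open_alcove:
  fixes x :: "real ^ 'n::{finite,linorder}"
  assumes x: "x \<in> regular_points k"
  shows "x \<in> open_alcove k x"
proof -
  have "of_int \<lfloor>psum j x - psum i x\<rfloor> < psum j x - psum i x"
    if "i < j" "j < CARD('n)" for i j
    using regular_point_gap[OF x that] by (metis Ints_of_int floor_less_iff less_le of_int_floor_le)
  then show ?thesis
    using x unfolding open_alcove_def regular_points_def by auto
qed

lemma open_alcove_subset_regular: "open_alcove k x \<subseteq> regular_points k"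
proof
  fix z assume z: "z \<in> open_alcove k x"
  have "psum j z - psum i z \<notin> \<int>" if ij: "i < j" "j < CARD('a)" for i j
  proof
    assume "psum j z - psum i z \<in> \<int>"
    then obtain l where l: "psum j z - psum i z = of_int l"
      by (elim Ints_cases)
    have "of_int \<lfloor>psum j x - psum i x\<rfloor> < psum j z - psum i z"
      "psum j z - psum i z < of_int \<lfloor>psum j x - psum i x\<rfloor> + 1"
      using z ij unfolding open_alcove_def by blast+
    then have "\<lfloor>psum j x - psum i x\<rfloor> < l" "l < \<lfloor>psum j x - psum i x\<rfloor> + 1"
      unfolding l by linarith+
    then show False by simp
  qed
  then show "z \<in> regular_points k"
    using z unfolding regular_points_def Union_alcove_hyperplanes open_alcove_def by blast
qed

lemma open_alcove_eq_Int:
  fixes x :: "real ^ 'n::{finite,linorder}"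
  shows "open_alcove k x = sum_hyperplane k \<inter> (\<Inter>j<CARD('n). \<Inter>i<j.
    {z. of_int \<lfloor>psum j x - psum i x\<rfloor> < gap_vec i j \<bullet> z} \<inter>
    {z. gap_vec i j \<bullet> z < of_int \<lfloor>psum j x - psum i x\<rfloor> + 1})"
  unfolding open_alcove_def inner_gap_vec by auto

lemma closed_alcove_eq_Int:
  fixes x :: "real ^ 'n::{finite,linorder}"
  shows "closed_alcove k x = sum_hyperplane k \<inter> (\<Inter>j<CARD('n). \<Inter>i<j.
    {z. gap_vec i j \<bullet> z \<ge> of_int \<lfloor>psum j x - psum i x\<rfloor>} \<inter>
    {z. gap_vec i j \<bullet> z \<le> of_int \<lfloor>psum j x - psum i x\<rfloor> + 1})"
  unfolding closed_alcove_def inner_gap_vec by auto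

lemma convex_open_alcove: "convex (open_alcove k x)"
  unfolding open_alcove_eq_Int
  by (intro convex_Int convex_INT convex_sum_hyperplane convex_halfspace_gt convex_halfspace_lt)

lemma openin_open_alcove: "openin (top_of_set (sum_hyperplane k)) (open_alcove k x)"
  unfolding open_alcove_eq_Int
  by (intro openin_open_Int open_INT open_Int ballI open_halfspace_gt open_halfspace_lt) auto

lemma convex_closed_alcove: "convex (closed_alcove k x)"
  unfolding closed_alcove_eq_Int
  by (intro convex_Int convex_INT convex_sum_hyperplane convex_halfspace_ge convex_halfspace_le)

lemma closed_closed_alcove: "closed (closed_alcove k x)"
  unfolding closed_alcove_eq_Int
  by (intro closed_Int closed_INT ballI closed_sum_hyperplane closed_halfspace_ge closed_halfspace_le)

text \<open>Along a connected set of regular points a gap is continuous and never an integer, so its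
  floor is constant. Conversely the open alcove is convex, hence connected.\<close>

lemma component_regular_points:
  fixes x :: "real ^ 'n::{finite,linorder}"
  assumes x: "x \<in> regular_points k"
  shows "connected_component_set (regular_points k) x = open_alcove k x" (is "?C = _")
proof
  show "open_alcove k x \<subseteq> ?C"
    using regular_point_mem_open_alcove[OF x] convex_connected[OF convex_open_alcove]
      open_alcove_subset_regular by (rule connected_component_maximal)
  show "?C \<subseteq> open_alcove k x"
  proof
    fix z assume z: "z \<in> ?C"
    have C: "?C \<subseteq> regular_points k" by (rule connected_component_subset)
    have xC: "x \<in> ?C" using x by simp
    have "of_int \<lfloor>psum j x - psum i x\<rfloor> < psum j z - psum i z \<and>
        psum j z - psum i z < of_int \<lfloor>psum j x - psum i x\<rfloor> + 1"
      if ij: "i < j" "j < CARD('n)" for i j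
    proof -
      have conn: "connected ((\<lambda>y. psum j y - psum i y) ` ?C)"
        by (intro connected_continuous_image continuous_intros) simp
      have mem: "psum j x - psum i x \<in> (\<lambda>y. psum j y - psum i y) ` ?C"
          "psum j z - psum i z \<in> (\<lambda>y. psum j y - psum i y) ` ?C"
        using xC z by auto
      have non: "of_int l \<notin> (\<lambda>y. psum j y - psum i y) ` ?C" for l
        using C regular_point_gap[of _ k i j] ij by (metis (no_types, lifting) Ints_of_int imageE subsetD)
      show ?thesis
      proof (intro conjI; rule ccontr)
        assume "\<not> of_int \<lfloor>psum j x - psum i x\<rfloor> < psum j z - psum i z"
        then show False
          using connectedD_interval[OF conn mem(2,1), of "of_int \<lfloor>psum j x - psum i x\<rfloor>"] non by simp
      next
        assume "\<not> psum j z - psum i z < of_int \<lfloor>psum j x - psum i x\<rfloor> + 1"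
        then show False
          using connectedD_interval[OF conn mem, of "of_int (\<lfloor>psum j x - psum i x\<rfloor> + 1)"]
            non[of "\<lfloor>psum j x - psum i x\<rfloor> + 1"]
          by (simp add: less_imp_le)
      qed
    qed
    moreover have "z \<in> sum_hyperplane k"
      using z C unfolding regular_points_def by blast
    ultimately show "z \<in> open_alcove k x"
      unfolding open_alcove_def by blast
  qed
qed

text \<open>Moving from a point \<open>z\<close> of the closed alcove a little towards
  \<open>x\<close>, which satisfies all inequalities strictly, makes them strict as well.\<close>

lemma closure_open_alcove:
  fixes x :: "real ^ 'n::{finite,linorder}"
  assumes x: "x \<in> regular_points k"
  shows "closure (open_alcove k x) = closed_alcove k x"
proof
  have "open_alcove k x \<subseteq> closed_alcove k x"
    unfolding open_alcove_def closed_alcove_def by (auto intro: less_imp_le)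
  then show "closure (open_alcove k x) \<subseteq> closed_alcove k x"
    by (simp add: closed_closed_alcove closure_minimal)
  show "closed_alcove k x \<subseteq> closure (open_alcove k x)"
  proof
    fix z assume z: "z \<in> closed_alcove k x"
    have xo: "x \<in> open_alcove k x" by (rule regular_point_mem_open_alcove[OF x])
    define g where "g e = z + e *\<^sub>R (x - z)" for e
    have "g e \<in> open_alcove k x" if e: "0 < e" "e \<le> 1" for e
    proof -
      have comb: "(1 - e) * a + e * b < c" if "a \<le> c" "b < c" for a b c :: real
      proof -
        have "(1 - e) * a \<le> (1 - e) * c" "e * b < e * c"
          using that e by (auto intro: mult_left_mono)
        then show ?thesis by (simp add: algebra_simps)
      qed
      have "of_int \<lfloor>psum j x - psum i x\<rfloor> < psum j (g e) - psum i (g e) \<and>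
          psum j (g e) - psum i (g e) < of_int \<lfloor>psum j x - psum i x\<rfloor> + 1"
        if ij: "i < j" "j < CARD('n)" for i j
      proof -
        let ?l = "of_int \<lfloor>psum j x - psum i x\<rfloor> :: real"
        have zb: "?l \<le> psum j z - psum i z" "psum j z - psum i z \<le> ?l + 1"
          using z ij unfolding closed_alcove_def by blast+
        have xb: "?l < psum j x - psum i x" "psum j x - psum i x < ?l + 1"
          using xo ij unfolding open_alcove_def by blast+
        have "psum j (g e) - psum i (g e) = (1 - e) * (psum j z - psum i z) + e * (psum j x - psum i x)"
          by (simp add: g_def algebra_simps)
        then show ?thesis
          using comb[of "psum j z - psum i z" "?l + 1" "psum j x - psum i x"]
            comb[of "- (psum j z - psum i z)" "- ?l" "- (psum j x - psum i x)"] zb xb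
          by (simp add: algebra_simps)
      qed
      moreover have "g e \<in> sum_hyperplane k"
        using z x unfolding closed_alcove_def regular_points_def
        by (simp add: g_def mem_sum_hyperplane)
      ultimately show ?thesis
        unfolding open_alcove_def by blast
    qed
    moreover have "((\<lambda>n. g (1 / real (Suc n))) \<longlongrightarrow> z + 0 *\<^sub>R (x - z)) sequentially"
      unfolding g_def by (intro tendsto_intros LIMSEQ_Suc[OF lim_1_over_n])
    ultimately show "z \<in> closure (open_alcove k x)"
      unfolding closure_sequential by (intro exI[of _ "\<lambda>n. g (1 / real (Suc n))"]) auto
  qed
qed

lemma alcoves_eq:
  "alcoves k = closed_alcove k ` (regular_points k :: (real ^ 'n::{finite,linorder}) set)"
proof -
  have "components (regular_points k) = open_alcove k ` (regular_points k :: (real, 'n) vec set)"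
    unfolding components_def by (intro image_cong refl) (simp add: component_regular_points)
  then have "alcoves k = (\<lambda>x. closure (open_alcove k x)) ` (regular_points k :: (real, 'n) vec set)"
    by (simp add: alcoves_def image_image flip: regular_points_def)
  also have "\<dots> = closed_alcove k ` regular_points k"
    by (intro image_cong refl closure_open_alcove)
  finally show ?thesis .
qed

lemma closed_alcove_gap:
  fixes x :: "real ^ 'n::{finite,linorder}"
  assumes "z \<in> closed_alcove k x" "w \<in> closed_alcove k x" "i < CARD('n)" "j < CARD('n)"
  shows "(psum j z - psum i z) - (psum j w - psum i w) \<le> 1"
proof -
  consider "i = j" | "i < j" | "j < i" by linarith
  then show ?thesis
  proof cases
    case 2
    then show ?thesis
      using assms unfolding closed_alcove_def by (smt (verit) mem_Collect_eq)
  next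
    case 3
    then show ?thesis
      using assms unfolding closed_alcove_def by (smt (verit) mem_Collect_eq)
  qed simp
qed

text \<open>If \<open>v\<close> and \<open>w\<close> were incomparable, their sums would differ by 1
  at some \<open>i\<close> and by -1 at some \<open>j\<close>. The gap between \<open>i\<close> and
  \<open>j\<close> would then differ by 2, but within a closed alcove a gap varies by at most
  one.\<close>

lemma alcove_chain_closed_alcove:
  fixes x :: "real ^ 'n::{finite,linorder}"
  shows "alcove_chain k (lattice_points (closed_alcove k x))"
  unfolding alcove_chain_def
proof (intro conjI ballI)
  show "lattice_points (closed_alcove k x) \<subseteq> lattice_points (sum_hyperplane k)"
    unfolding lattice_points_def closed_alcove_def by blast
  fix v w assume vw: "v \<in> lattice_points (closed_alcove k x)" "w \<in> lattice_points (closed_alcove k x)"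
  have H: "v \<in> sum_hyperplane k" "w \<in> sum_hyperplane k"
    using vw unfolding lattice_points_def closed_alcove_def by blast+
  have gap: "(psum j v - psum i v) - (psum j w - psum i w) \<le> 1"
    if "i < CARD('n)" "j < CARD('n)" for i j
    using vw that closed_alcove_gap unfolding lattice_points_def by blast
  have 0: "0 < CARD('n)" by simp
  \<comment> \<open>The gap with index 0 is the partial sum itself, so its variation is bounded by
    one as well.\<close>
  have pair: "psum j v - psum j w \<in> {-1, 0, 1}" for j
  proof (cases "j < CARD('n)")
    case True
    have "psum j v - psum j w \<in> \<int>"
      using vw by (intro Ints_diff) (blast intro: psum_lattice)+
    then obtain l where l: "psum j v - psum j w = of_int l"
      by (elim Ints_cases)
    have "of_int l \<le> (1::real)" "of_int (- l) \<le> (1::real)"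
      using gap[OF 0 True] gap[OF True 0] l by simp_all
    then have "l = -1 \<or> l = 0 \<or> l = 1"
      by linarith
    then show ?thesis using l by auto
  next
    case False
    then show ?thesis
      using H by (simp add: psum_hyperplane_ge)
  qed
  show "near v w \<or> near w v"
  proof (rule ccontr)
    assume "\<not> (near v w \<or> near w v)"
    then obtain i j where ij: "\<not> (psum i v \<le> psum i w \<and> psum i w \<le> psum i v + 1)"
        "\<not> (psum j w \<le> psum j v \<and> psum j v \<le> psum j w + 1)"
      unfolding near_def by blast
    then have d: "psum i v - psum i w = 1" "psum j v - psum j w = -1"
      using pair[of i] pair[of j] by auto
    have "i < CARD('n)" "j < CARD('n)"
      using d H psum_hyperplane_ge[of v k] psum_hyperplane_ge[of w k]
      by (metis diff_self linorder_not_less zero_neq_one zero_neq_neg_one)+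
    then show False
      using gap[of j i] d by simp
  qed
qed

text \<open>A closed alcove is cut out by integral bounds on gaps. Rounding respects these, so the
  chain of each of its points stays inside.\<close>

lemma closed_alcove_eq_hull:
  fixes x :: "real ^ 'n::{finite,linorder}"
  shows "closed_alcove k x = convex hull (lattice_points (closed_alcove k x))"
proof
  show "convex hull (lattice_points (closed_alcove k x)) \<subseteq> closed_alcove k x"
    by (rule hull_minimal) (auto simp: lattice_points_def convex_closed_alcove)
  show "closed_alcove k x \<subseteq> convex hull (lattice_points (closed_alcove k x))"
  proof
    fix z assume z: "z \<in> closed_alcove k x"
    then have zH: "z \<in> sum_hyperplane k" by (simp add: closed_alcove_def)
    have "(\<lambda>t. round_at t z) ` {0..<1} \<subseteq> lattice_points (closed_alcove k x)"
    proof clarify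
      fix t :: real assume t: "t \<in> {0..<1}"
      then have t: "0 \<le> t" "t < 1" by auto
      have "of_int \<lfloor>psum j x - psum i x\<rfloor> \<le> psum j (round_at t z) - psum i (round_at t z) \<and>
          psum j (round_at t z) - psum i (round_at t z) \<le> of_int \<lfloor>psum j x - psum i x\<rfloor> + 1"
        if ij: "i < j" "j < CARD('n)" for i j
      proof -
        have "of_int \<lfloor>psum j x - psum i x\<rfloor> \<le> psum j z - psum i z"
            "psum j z - psum i z \<le> of_int \<lfloor>psum j x - psum i x\<rfloor> + 1"
          using z ij unfolding closed_alcove_def by blast+
        then show ?thesis
          using round_at_gap_le[OF zH t, of j i "\<lfloor>psum j x - psum i x\<rfloor> + 1"]
            round_at_gap_le[OF zH t, of i j "- \<lfloor>psum j x - psum i x\<rfloor>"] by simp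
      qed
      then show "round_at t z \<in> lattice_points (closed_alcove k x)"
        using round_at_lattice[OF zH t] unfolding closed_alcove_def lattice_points_def by blast
    qed
    then show "z \<in> convex hull (lattice_points (closed_alcove k x))"
      using mem_hull_round_at[OF zH] hull_mono by blast
  qed
qed

text \<open>A nonempty relatively open subset has the dimension of the hyperplane,
  \<open>n - 1\<close>, and the dimension of a chain simplex is one less than its number of
  vertices.\<close>

lemma card_lattice_points_alcove:
  fixes x :: "real ^ 'n::{finite,linorder}"
  assumes x: "x \<in> regular_points k"
  shows "card (lattice_points (closed_alcove k x)) = CARD('n)"
proof -
  have "aff_dim (open_alcove k x) = aff_dim (sum_hyperplane k :: (real, 'n) vec set)"
    using openin_open_alcove affine_sum_hyperplane regular_point_mem_open_alcove[OF x]
    by (intro aff_dim_openin) auto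
  moreover have "open_alcove k x \<subseteq> closed_alcove k x"
    using closure_open_alcove[OF x] closure_subset by blast
  ultimately have "aff_dim (sum_hyperplane k :: (real, 'n) vec set) \<le> aff_dim (closed_alcove k x)"
    by (metis aff_dim_subset)
  then have "int CARD('n) - 1 \<le> int (card (lattice_points (closed_alcove k x))) - 1"
    using aff_dim_alcove_chain[OF alcove_chain_closed_alcove, of k x] closed_alcove_eq_hull[of k x]
    by (simp add: aff_dim_sum_hyperplane)
  then show ?thesis
    using card_alcove_chain_le[OF alcove_chain_closed_alcove, of k x] by simp
qed

text \<open>The hull has full dimension, so the countably many walls cannot cover it and it contains
  a regular point \<open>x\<close>. Every vertex lies in the closed alcove of \<open>x\<close>, and
  both vertex sets have \<open>n\<close> elements.\<close>

lemma full_chain_hull_eq_alcove: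
  fixes D :: "(real ^ 'n::{finite,linorder}) set"
  assumes D: "alcove_chain k D" "card D = CARD('n)"
  obtains x where "x \<in> regular_points k" "convex hull D = closed_alcove k x"
proof -
  let ?W = "\<lambda>(i, j, l::int). {x :: (real, 'n) vec. psum j x - psum i x = of_int l}"
  let ?\<F> = "?W ` {(i, j, l). i < j \<and> j < CARD('n)}"
  have "convex hull D \<subseteq> closure (convex hull D - \<Union>?\<F>)"
  proof (rule dense_Diff_lower_dim)
    fix F assume "F \<in> ?\<F>"
    then obtain i j l where ij: "i < j" "j < CARD('n)" and F: "F = {x. psum j x - psum i x = of_int l}"
      by auto
    show "closed F"
      unfolding F inner_gap_vec[symmetric] by (rule closed_hyperplane)
    have "aff_dim (convex hull D \<inter> F) \<le> int CARD('n) - 2"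
      using aff_dim_wall[OF ij, of k "of_int l"] aff_dim_subset[of "convex hull D \<inter> F" "sum_hyperplane k \<inter> F"]
        hull_alcove_chain_subset[OF D(1)] unfolding F by fastforce
    then show "aff_dim (convex hull D \<inter> F) < aff_dim (convex hull D)"
      using D by (simp only: aff_dim_alcove_chain)
  qed (use D in \<open>auto simp: closed_chain_hull\<close>)
  moreover have "convex hull D \<noteq> {}"
    using D by auto
  ultimately have "convex hull D - \<Union>?\<F> \<noteq> {}"
    by (metis closure_empty subset_empty)
  then obtain x where x: "x \<in> convex hull D" "x \<notin> \<Union>?\<F>"
    by blast
  have reg: "x \<in> regular_points k"
    unfolding regular_points_def Union_alcove_hyperplanes
  proof (intro DiffI notI)
    show "x \<in> sum_hyperplane k"
      using x hull_alcove_chain_subset[OF D(1)] by blast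
    assume "x \<in> {x. \<exists>i j. i < j \<and> j < CARD('n) \<and> psum j x - psum i x \<in> \<int>}"
    then obtain i j l where "i < j" "j < CARD('n)" "psum j x - psum i x = of_int l"
      by (auto elim: Ints_cases)
    then show False
      using x(2) by auto
  qed
  have "D \<subseteq> lattice_points (closed_alcove k x)"
  proof
    fix v assume v: "v \<in> D"
    have lat: "v \<in> lattice_points (sum_hyperplane k)"
      using D v unfolding alcove_chain_def by blast
    have "of_int \<lfloor>psum j x - psum i x\<rfloor> \<le> psum j v - psum i v \<and>
        psum j v - psum i v \<le> of_int \<lfloor>psum j x - psum i x\<rfloor> + 1"
      if ij: "i < j" "j < CARD('n)" for i j
    proof -
      have "D \<subseteq> {w. gap_vec i j \<bullet> w \<ge> psum j v - psum i v - 1} \<inter> {w. gap_vec i j \<bullet> w \<le> psum j v - psum i v + 1}"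
      proof
        fix w assume "w \<in> D"
        then have "near v w \<or> near w v"
          using D v unfolding alcove_chain_def by blast
        then show "w \<in> {w. gap_vec i j \<bullet> w \<ge> psum j v - psum i v - 1} \<inter> {w. gap_vec i j \<bullet> w \<le> psum j v - psum i v + 1}"
          unfolding near_def inner_gap_vec by (smt (verit) IntI mem_Collect_eq)
      qed
      then have "convex hull D \<subseteq> {w. gap_vec i j \<bullet> w \<ge> psum j v - psum i v - 1} \<inter> {w. gap_vec i j \<bullet> w \<le> psum j v - psum i v + 1}"
        by (intro hull_minimal convex_Int convex_halfspace_ge convex_halfspace_le)
      then have near: "psum j x - psum i x \<ge> psum j v - psum i v - 1" "psum j x - psum i x \<le> psum j v - psum i v + 1"
        using x(1) by (auto simp: inner_gap_vec)
      have "psum j v - psum i v \<in> \<int>"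
        using psum_lattice[OF lat] by simp
      then obtain a where a: "psum j v - psum i v = of_int a"
        by (elim Ints_cases)
      have "of_int \<lfloor>psum j x - psum i x\<rfloor> < psum j x - psum i x" "psum j x - psum i x < of_int \<lfloor>psum j x - psum i x\<rfloor> + 1"
        using regular_point_mem_open_alcove[OF reg] ij unfolding open_alcove_def by blast+
      \<comment> \<open>The gap of \<open>x\<close> is not an integer, so an integer at distance at
        most one from it is its floor or its ceiling.\<close>
      then have "\<lfloor>psum j x - psum i x\<rfloor> \<le> a" "a \<le> \<lfloor>psum j x - psum i x\<rfloor> + 1"
        using near unfolding a by linarith+
      then show ?thesis
        unfolding a by linarith
    qed
    then show "v \<in> lattice_points (closed_alcove k x)"
      using lat unfolding lattice_points_def closed_alcove_def by blast
  qed
  then have "D = lattice_points (closed_alcove k x)"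
    using D card_lattice_points_alcove[OF reg] finite_alcove_chain[OF alcove_chain_closed_alcove]
    by (metis card_subset_eq)
  then show thesis
    using that reg closed_alcove_eq_hull by metis
qed

lemma alcoves_in_eq_chain_simplices:
  fixes P :: "(real ^ 'n::{finite,linorder}) set"
  assumes "convex P"
  shows "alcoves_in k P = chain_simplices k P"
proof (intro equalityI subsetI)
  fix A assume "A \<in> alcoves_in k P"
  then obtain x where x: "x \<in> regular_points k" and A: "A = closed_alcove k x" "A \<subseteq> P"
    unfolding alcoves_in_def alcoves_eq by blast
  have "lattice_points A \<in> full_chains k P"
    using alcove_chain_closed_alcove[of k x] card_lattice_points_alcove[OF x] A
    unfolding full_chains_def by (auto simp: lattice_points_def)
  then show "A \<in> chain_simplices k P"
    using closed_alcove_eq_hull[of k x] A unfolding chain_simplices_def by blast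
next
  fix A assume "A \<in> chain_simplices k P"
  then obtain D where D: "alcove_chain k D" "D \<subseteq> P" "card D = CARD('n)" and A: "A = convex hull D"
    unfolding chain_simplices_def full_chains_def by blast
  obtain x where "x \<in> regular_points k" "convex hull D = closed_alcove k x"
    by (rule full_chain_hull_eq_alcove[OF D(1,3)])
  moreover have "convex hull D \<subseteq> P"
    using D(2) assms by (rule hull_minimal)
  ultimately show "A \<in> alcoves_in k P"
    using A unfolding alcoves_in_def alcoves_eq by auto
qed

subsection \<open>Triangulations and facets\<close>

lemma finite_lattice_points:
  fixes P :: "(real ^ 'n::finite) set"
  assumes "bounded P"
  shows "finite (lattice_points P)"
proof -
  obtain B where B: "\<And>x. x \<in> P \<Longrightarrow> norm x \<le> B"
    using assms by (auto simp: bounded_iff)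
  have "lattice_points P \<subseteq> (\<lambda>f. \<chi> i. real_of_int (f i)) ` (UNIV \<rightarrow>\<^sub>E {- \<lceil>B\<rceil>..\<lceil>B\<rceil>})"
  proof
    fix v assume v: "v \<in> lattice_points P"
    have "\<lfloor>v $ i\<rfloor> \<in> {- \<lceil>B\<rceil>..\<lceil>B\<rceil>}" for i
    proof -
      have "\<bar>v $ i\<bar> \<le> B"
        using B[of v] v component_le_norm_cart[of v i] by (auto simp: lattice_points_def)
      moreover have "of_int \<lfloor>v $ i\<rfloor> = v $ i"
        using v by (simp add: lattice_points_def)
      ultimately have "of_int \<bar>\<lfloor>v $ i\<rfloor>\<bar> \<le> B" by (simp only: of_int_abs)
      then have "\<bar>\<lfloor>v $ i\<rfloor>\<bar> \<le> \<lceil>B\<rceil>" by linarith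
      then show ?thesis by auto
    qed
    moreover have "v = (\<chi> i. real_of_int \<lfloor>v $ i\<rfloor>)"
      using v by (simp add: lattice_points_def vec_eq_iff)
    ultimately show "v \<in> (\<lambda>f. \<chi> i. real_of_int (f i)) ` (UNIV \<rightarrow>\<^sub>E {- \<lceil>B\<rceil>..\<lceil>B\<rceil>})"
      by (intro image_eqI[of _ _ "\<lambda>i. \<lfloor>v $ i\<rfloor>"]) auto
  qed
  then show ?thesis
    by (rule finite_subset) (intro finite_imageI finite_PiE; simp)
qed

lemma finite_chains:
  assumes "bounded P"
  shows "finite {C. alcove_chain k C \<and> C \<subseteq> P}"
proof (rule finite_subset)
  show "{C. alcove_chain k C \<and> C \<subseteq> P} \<subseteq> Pow (lattice_points P)"
    unfolding alcove_chain_def lattice_points_def by blast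
qed (simp add: finite_lattice_points[OF assms])

lemma finite_full_chains: "bounded P \<Longrightarrow> finite (full_chains k P)"
  by (rule finite_subset[OF _ finite_chains[of P k]]) (auto simp: full_chains_def)

text \<open>Faces of a simplex are hulls of subsets of its vertices, and subsets of chains are
  chains. The empty chain supplies the empty face.\<close>

lemma simplicial_complex_chains:
  assumes "bounded P"
  shows "simplicial_complex {convex hull C | C. alcove_chain k C \<and> C \<subseteq> P}" (is "simplicial_complex ?K")
  unfolding simplicial_complex_def
proof (intro conjI allI impI ballI)
  show "finite ?K"
    by (rule finite_subset[OF _ finite_imageI[OF finite_chains[OF assms, of k], of "\<lambda>C. convex hull C"]]) auto
next
  fix S assume "S \<in> ?K"
  then obtain C where C: "alcove_chain k C" "S = convex hull C" by blast
  then have "(int (card C) - 1) simplex S"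
    using alcove_chain_independent[OF C(1)] unfolding simplex_def by (intro exI[of _ C]) simp
  then show "\<exists>n. n simplex S" by blast
next
  fix F S assume FS: "S \<in> ?K \<and> F face_of S"
  then obtain C where C: "alcove_chain k C" "C \<subseteq> P" "S = convex hull C" by blast
  then have "F face_of convex hull C" using FS by simp
  then obtain C' where C': "C' \<subseteq> C" "F = convex hull C'"
    unfolding face_of_convex_hull_affine_independent[OF alcove_chain_independent[OF C(1)]] by blast
  then have "alcove_chain k C'" "C' \<subseteq> P"
    using C alcove_chain_subset[of k C C'] by auto
  then show "F \<in> ?K"
    using C'(2) by blast
next
  fix S S' assume SS: "S \<in> ?K \<and> S' \<in> ?K"
  then obtain C where C: "alcove_chain k C" "S = convex hull C" by blast
  obtain D where D: "alcove_chain k D" "S' = convex hull D" using SS by blast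
  have eq: "S \<inter> S' = convex hull (C \<inter> D)"
    unfolding C(2) D(2) using C(1) D(1) by (rule chain_hull_Int)
  have "convex hull (C \<inter> D) face_of convex hull C"
    unfolding face_of_convex_hull_affine_independent[OF alcove_chain_independent[OF C(1)]]
    by (intro exI[of _ "C \<inter> D"]) simp
  then show "S \<inter> S' face_of S"
    unfolding eq using C(2) by simp
qed

text \<open>Since \<open>P\<close> is full-dimensional in its hyperplane, the low-dimensional simplices of a finite
  complex cannot cover an open piece of it.\<close>

lemma chain_cover_imp_full_chain_cover:
  fixes P :: "(real ^ 'n::{finite,linorder}) set"
  assumes P: "convex P" "compact P" "aff_dim P = int CARD('n) - 1"
    and cover: "P \<subseteq> \<Union>{convex hull C | C. alcove_chain k C \<and> C \<subseteq> P}"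
  shows "P = \<Union>(chain_simplices k P)"
proof
  have bd: "bounded P" using P by (simp add: compact_imp_bounded)
  let ?\<L> = "{convex hull C | C. alcove_chain k C \<and> C \<subseteq> P \<and> card C \<noteq> CARD('n)}"
  have fin: "finite ?\<L>"
    by (rule finite_subset[OF _ finite_imageI[OF finite_chains[OF bd, of k], of "\<lambda>C. convex hull C"]]) auto
  have "P \<subseteq> closure (P - \<Union>?\<L>)"
  proof (rule dense_Diff_lower_dim)
    fix F assume "F \<in> ?\<L>"
    then obtain C where C: "alcove_chain k C" "card C \<noteq> CARD('n)" "F = convex hull C"
      by blast
    show "closed F" using C by (simp add: closed_chain_hull)
    have "aff_dim (P \<inter> F) \<le> aff_dim F"
      by (simp add: aff_dim_subset)
    also have "\<dots> < int CARD('n) - 1"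
      using C card_alcove_chain_le[OF C(1)] aff_dim_alcove_chain[OF C(1)] by simp
    finally show "aff_dim (P \<inter> F) < aff_dim P"
      using P by simp
  qed (simp_all add: P fin compact_imp_closed countable_finite)
  also have "\<dots> \<subseteq> \<Union>(chain_simplices k P)"
  proof (rule closure_minimal)
    show "P - \<Union>?\<L> \<subseteq> \<Union>(chain_simplices k P)"
    proof
      fix x assume x: "x \<in> P - \<Union>?\<L>"
      then have "x \<in> \<Union>{convex hull C | C. alcove_chain k C \<and> C \<subseteq> P}"
        using cover by (rule DiffD1[THEN rev_subsetD])
      then obtain C where "alcove_chain k C" "C \<subseteq> P" "x \<in> convex hull C"
        by blast
      moreover from this x have "card C = CARD('n)" by blast
      ultimately show "x \<in> \<Union>(chain_simplices k P)"
        unfolding chain_simplices_def full_chains_def by blast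
    qed
    show "closed (\<Union>(chain_simplices k P))"
      unfolding chain_simplices_def
    proof (rule closed_Union)
      show "finite ((hull) convex ` full_chains k P)"
        using finite_full_chains[OF bd] by blast
    qed (auto simp: full_chains_def closed_chain_hull)
  qed
  finally show "P \<subseteq> \<Union>(chain_simplices k P)" .
  show "\<Union>(chain_simplices k P) \<subseteq> P"
    using hull_minimal[of _ P convex] P(1) unfolding chain_simplices_def full_chains_def by blast
qed

text \<open>A full chain is maximal because no chain has more than \<open>n\<close> elements.
  Conversely the barycenter of any chain in \<open>P\<close> lies in some full simplex, which then
  contains the whole chain.\<close>

lemma chain_simplices_triangulation:
  fixes P :: "(real ^ 'n::{finite,linorder}) set"
  assumes P: "convex P" "compact P" "aff_dim P = int CARD('n) - 1"
    and cover: "P \<subseteq> \<Union>{convex hull C | C. alcove_chain k C \<and> C \<subseteq> P}"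
  shows "maximal_simplices_of_triangulation (chain_simplices k P) P"
proof -
  let ?K = "{convex hull C | C. alcove_chain k C \<and> C \<subseteq> P}"
  have bd: "bounded P" using P by (simp add: compact_imp_bounded)
  have "convex hull C \<subseteq> P" if "C \<subseteq> P" for C
    using that P(1) by (rule hull_minimal)
  then have union: "\<Union>?K = P"
    using cover by blast
  have full: "P = \<Union>(chain_simplices k P)"
    using P cover by (rule chain_cover_imp_full_chain_cover)
  have "P \<noteq> {}"
    using P(3) by auto
  have "chain_simplices k P = {S \<in> ?K. \<forall>S'\<in>?K. S \<subseteq> S' \<longrightarrow> S' = S}" (is "_ = ?M")
  proof (intro equalityI subsetI)
    fix S assume "S \<in> chain_simplices k P"
    then obtain C where C: "alcove_chain k C" "C \<subseteq> P" "card C = CARD('n)" "S = convex hull C"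
      unfolding chain_simplices_def full_chains_def by blast
    have "S' = S" if S': "S' \<in> ?K" "S \<subseteq> S'" for S'
    proof -
      obtain D where D: "alcove_chain k D" "S' = convex hull D"
        using S' by blast
      have "C \<subseteq> convex hull D"
        using hull_subset[of C convex] C(4) D(2) S'(2) by simp
      with C(1) D(1) have "C \<subseteq> D"
        by (rule chain_subset_if_hull_subset)
      then have "C = D"
        using card_alcove_chain_le[OF D(1)] C(3) finite_alcove_chain[OF D(1)]
        by (metis card_seteq)
      then show ?thesis using C D by simp
    qed
    then show "S \<in> ?M"
      using C by blast
  next
    fix S assume S: "S \<in> ?M"
    then obtain C where C: "alcove_chain k C" "C \<subseteq> P" "S = convex hull C"
      by blast
    obtain D where D: "D \<in> full_chains k P" "C \<subseteq> D"
    proof (cases "C = {}")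
      case True
      then show thesis
        using that full \<open>P \<noteq> {}\<close> unfolding chain_simplices_def by blast
    next
      case False
      let ?x = "\<Sum>v\<in>C. (1 / real (card C)) *\<^sub>R v"
      have fin: "finite C" using C by (simp add: finite_alcove_chain)
      then have "?x \<in> convex hull C"
        using False by (auto simp: convex_hull_finite intro!: exI[of _ "\<lambda>_. 1 / real (card C)"])
      then have "?x \<in> P"
        using C P(1) by (meson hull_minimal subsetD)
      then obtain D where D: "D \<in> full_chains k P" "?x \<in> convex hull D"
        using full unfolding chain_simplices_def by blast
      then have "C \<subseteq> D"
        using chain_barycenter_mem[OF C(1) _ False, of D] unfolding full_chains_def by blast
      then show thesis using that D by blast
    qed
    have "convex hull D \<in> ?K"
      using D unfolding full_chains_def by blast
    moreover have "S \<subseteq> convex hull D"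
      using C D hull_mono by blast
    ultimately have "S = convex hull D"
      using S by blast
    then show "S \<in> chain_simplices k P"
      using D unfolding chain_simplices_def by blast
  qed
  then show ?thesis
    unfolding maximal_simplices_of_triangulation_def
    using simplicial_complex_chains[OF bd, of k] union by blast
qed

lemma alcoved_polytope_triangulation:
  fixes P :: "(real ^ 'n::{finite,linorder}) set"
  assumes alc: "alcoved_polytope k P" and dim: "aff_dim P = int CARD('n) - 1"
  shows "maximal_simplices_of_triangulation (chain_simplices k P) P"
proof -
  have poly: "polytope P" and H: "P \<subseteq> sum_hyperplane k"
    using alc unfolding alcoved_polytope_def by blast+
  show ?thesis
  proof (rule chain_simplices_triangulation)
    show "convex P" "compact P"
      using poly by (auto simp: polytope_imp_convex polytope_imp_compact)
    show "P \<subseteq> \<Union>{convex hull C | C. alcove_chain k C \<and> C \<subseteq> P}"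
    proof
      fix x assume x: "x \<in> P"
      then have xH: "x \<in> sum_hyperplane k" using H by blast
      have "(\<lambda>t. round_at t x) ` {0..<1} \<subseteq> P"
      proof clarify
        fix t :: real assume "t \<in> {0..<1}"
        then have t: "0 \<le> t" "t < 1" by auto
        show "round_at t x \<in> P"
        proof (rule alcoved_polytope_memI[OF alc, of "{x}"])
          show "round_at t x \<in> sum_hyperplane k"
            using round_at_lattice[OF xH t] by (simp add: lattice_points_def)
        qed (use x round_at_gap_le[OF xH t] in auto)
      qed
      then show "x \<in> \<Union>{convex hull C | C. alcove_chain k C \<and> C \<subseteq> P}"
        using alcove_chain_round_at[OF xH] mem_hull_round_at[OF xH] by blast
    qed
  qed (rule dim)
qed

section \<open>From a cover by alcoves back to integral inequalities\<close>

lemma maximal_simplices_Union: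
  assumes "maximal_simplices_of_triangulation \<T> P"
  shows "P = \<Union>\<T>"
proof -
  obtain \<K> where K: "simplicial_complex \<K>" "\<Union>\<K> = P" "\<T> = {S \<in> \<K>. \<forall>S'\<in>\<K>. S \<subseteq> S' \<longrightarrow> S' = S}"
    using assms unfolding maximal_simplices_of_triangulation_def by blast
  have "finite \<K>" using K(1) by (simp add: simplicial_complex_def)
  have "\<exists>S'\<in>\<T>. S \<subseteq> S'" if S: "S \<in> \<K>" for S
  proof -
    obtain S' where "S' \<in> \<K>" "S \<subseteq> S'" "\<forall>T\<in>\<K>. S' \<subseteq> T \<longrightarrow> S' = T"
      using finite_has_maximal2[OF \<open>finite \<K>\<close> S] by blast
    then show ?thesis
      unfolding K(3) by (intro bexI[of _ S']) auto
  qed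
  then have "\<Union>\<K> \<subseteq> \<Union>\<T>" by (meson Sup_mono)
  moreover have "\<T> \<subseteq> \<K>" unfolding K(3) by (rule Collect_restrict)
  ultimately show ?thesis
    unfolding K(2)[symmetric] by (simp add: Union_mono subset_antisym)
qed

text \<open>Finitely many alcoves cover \<open>F\<close>, so one of them meets \<open>F\<close> in
  dimension \<open>n - 2\<close>. That intersection is a proper face of the alcove, hence lies in
  one of its walls. By equality of dimensions the wall, cut with the hyperplane, is the affine hull
  of \<open>F\<close>.\<close>

lemma facet_in_wall:
  fixes P :: "(real ^ 'n::{finite,linorder}) set"
  assumes P: "polytope P" "aff_dim P = int CARD('n) - 1" "P \<subseteq> sum_hyperplane k"
    and cover: "P = \<Union>(chain_simplices k P)" and F: "F facet_of P"
  obtains i j and l :: int where "i < j" "j < CARD('n)" "F = P \<inter> {x. psum j x - psum i x = of_int l}"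
proof -
  have conv: "convex P" and bd: "bounded P"
    using P by (auto simp: polytope_imp_convex polytope_imp_bounded)
  have Fface: "F face_of P" and Fne: "F \<noteq> {}" and Fdim: "aff_dim F = int CARD('n) - 2"
    using F P(2) by (auto simp: facet_of_def)
  have Fconv: "convex F" and Fcl: "closed F"
    using Fface P(1) by (auto simp: face_of_imp_convex face_of_polytope_polytope polytope_imp_closed)
  have "\<exists>D\<in>full_chains k P. aff_dim (F \<inter> convex hull D) \<ge> aff_dim F"
  proof (rule ccontr)
    assume "\<not> ?thesis"
    then have "F \<subseteq> closure (F - \<Union>(chain_simplices k P))"
      using Fconv Fcl finite_full_chains[OF bd, of k]
      by (intro dense_Diff_lower_dim)
        (auto simp: chain_simplices_def full_chains_def closed_chain_hull countable_finite)
    moreover have "F - \<Union>(chain_simplices k P) = {}"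
      using cover face_of_imp_subset[OF Fface] by blast
    ultimately show False using Fne by simp
  qed
  then obtain D where D: "alcove_chain k D" "D \<subseteq> P" "card D = CARD('n)"
    and FD: "aff_dim (F \<inter> convex hull D) \<ge> aff_dim F"
    unfolding full_chains_def by blast
  obtain x where x: "x \<in> regular_points k" "convex hull D = closed_alcove k x"
    by (rule full_chain_hull_eq_alcove[OF D(1,3)])
  let ?B = "closed_alcove k x"
  let ?F = "F \<inter> ?B"
  have BP: "?B \<subseteq> P"
    using D conv x by (metis hull_minimal)
  have dimB: "aff_dim ?B = int CARD('n) - 1"
    using aff_dim_alcove_chain[OF D(1)] D(3) x by simp
  have Fface': "?F face_of ?B"
    using face_of_slice[OF Fface convex_closed_alcove[of k x]] BP by (simp add: Int_absorb1)
  have dimF': "aff_dim ?F = int CARD('n) - 2"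
    using FD Fdim aff_dim_subset[of ?F F] x by simp
  have "?F \<noteq> {}"
    using dimF' Fdim Fne by (metis aff_dim_empty)
  then obtain w where w: "w \<in> rel_interior ?F"
    using face_of_imp_convex[OF Fface'] by (metis ex_in_conv rel_interior_eq_empty)
  then have wF: "w \<in> ?F" using rel_interior_subset by blast
  \<comment> \<open>Otherwise the face \<open>?F\<close> would contain a relative interior point of
    the alcove, hence the whole alcove, against the dimensions.\<close>
  have "w \<notin> open_alcove k x"
  proof
    assume wo: "w \<in> open_alcove k x"
    have "open_alcove k x \<subseteq> rel_interior ?B"
    proof (rule rel_interior_maximal)
      show "open_alcove k x \<subseteq> ?B"
        using closure_open_alcove[OF x(1)] closure_subset by blast
      show "openin (top_of_set (affine hull ?B)) (open_alcove k x)"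
        using affine_hull_full_chain[OF D(1,3)] openin_open_alcove x(2) by metis
    qed
    then have "?B \<subseteq> ?F"
      using subset_of_face_of[OF Fface', of ?B] wo wF by blast
    then show False
      using aff_dim_subset[of ?B ?F] dimB dimF' by simp
  qed
  moreover have "w \<in> sum_hyperplane k" "w \<in> ?B"
    using wF unfolding closed_alcove_def by auto
  ultimately obtain i j where ij: "i < j" "j < CARD('n)"
    and strict: "\<not> (of_int \<lfloor>psum j x - psum i x\<rfloor> < psum j w - psum i w \<and>
        psum j w - psum i w < of_int \<lfloor>psum j x - psum i x\<rfloor> + 1)"
    unfolding open_alcove_def by blast
  let ?l = "\<lfloor>psum j x - psum i x\<rfloor>"
  have bounds: "of_int ?l \<le> gap_vec i j \<bullet> z" "gap_vec i j \<bullet> z \<le> of_int (?l + 1)" if "z \<in> ?B" for z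
    using that ij unfolding closed_alcove_def inner_gap_vec by auto
  have "\<exists>l::int. gap_vec i j \<bullet> w = of_int l \<and> (?B \<inter> {x. gap_vec i j \<bullet> x = of_int l}) face_of ?B"
  proof -
    have "gap_vec i j \<bullet> w = of_int ?l \<or> gap_vec i j \<bullet> w = of_int (?l + 1)"
      using strict bounds[OF \<open>w \<in> ?B\<close>] by (auto simp: inner_gap_vec)
    moreover have "(?B \<inter> {x. gap_vec i j \<bullet> x = of_int ?l}) face_of ?B"
      using bounds by (intro face_of_Int_supporting_hyperplane_ge convex_closed_alcove) auto
    moreover have "(?B \<inter> {x. gap_vec i j \<bullet> x = of_int (?l + 1)}) face_of ?B"
      using bounds by (intro face_of_Int_supporting_hyperplane_le convex_closed_alcove) auto
    ultimately show ?thesis by blast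
  qed
  then obtain l :: int where wl: "gap_vec i j \<bullet> w = of_int l"
    and wall: "(?B \<inter> {x. gap_vec i j \<bullet> x = of_int l}) face_of ?B"
    by blast
  let ?W = "sum_hyperplane k \<inter> {x :: (real, 'n) vec. psum j x - psum i x = of_int l}"
  \<comment> \<open>The wall cuts the alcove in a face. It contains the relative interior point
    \<open>w\<close> of \<open>?F\<close>, hence all of \<open>?F\<close>.\<close>
  have "?F \<subseteq> ?B \<inter> {x. gap_vec i j \<bullet> x = of_int l}"
    using wall by (rule subset_of_face_of) (use w wl wF in auto)
  then have FW: "?F \<subseteq> ?W"
    unfolding inner_gap_vec closed_alcove_def by blast
  have affW: "affine ?W"
    unfolding inner_gap_vec[symmetric] by (intro affine_Int affine_sum_hyperplane affine_hyperplane)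
  have "aff_dim ?W = int CARD('n) - 2"
    using aff_dim_wall[OF ij, of k "of_int l"] aff_dim_subset[OF FW] dimF' by simp
  then have hullF': "affine hull ?F = ?W"
    using affine_dim_equal[of "affine hull ?F" ?W] hull_minimal[OF FW, of affine] affW dimF' \<open>?F \<noteq> {}\<close>
    by simp
  have hullF: "affine hull ?F = affine hull F"
    using affine_dim_equal[of "affine hull ?F" "affine hull F"] hull_mono[of ?F F affine] dimF' Fdim \<open>?F \<noteq> {}\<close>
    by simp
  have "F = affine hull F \<inter> P"
    using conv Fface by (rule face_of_imp_eq_affine_Int)
  then have "F = P \<inter> {x. psum j x - psum i x = of_int l}"
    using hullF hullF' P(3) by blast
  then show thesis
    using that ij by blast
qed

text \<open>A segment from one side to the other crosses the level \<open>c\<close> at an inner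
  point, which lies in the face \<open>F\<close>. Then its endpoint \<open>p\<close> lies in
  \<open>F\<close> too, although \<open>f p < c\<close>.\<close>

lemma face_wall_one_sided:
  assumes "convex P" "F face_of P" "F = P \<inter> {x. f x = c}" "linear f" "p \<in> P" "q \<in> P"
  shows "\<not> (f p < (c::real) \<and> c < f q)"
proof
  assume pq: "f p < c \<and> c < f q"
  define t where "t = (c - f p) / (f q - f p)"
  have t: "0 < t" "t < 1"
    using pq by (auto simp: t_def field_simps)
  let ?w = "(1 - t) *\<^sub>R p + t *\<^sub>R q"
  have "f ?w = f p + t * (f q - f p)"
    by (simp add: linear_add[OF assms(4)] linear_scale[OF assms(4)]) (simp add: algebra_simps)
  also have "\<dots> = c"
    using pq by (simp add: t_def)
  finally have fw: "f ?w = c" .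
  have "p \<noteq> q" using pq by auto
  then have seg: "?w \<in> open_segment p q"
    using t by (auto simp: in_segment)
  have "?w \<in> P"
    using assms(1,5,6) t by (intro convexD_alt) auto
  then have "?w \<in> F"
    using assms(3) fw by simp
  then have "p \<in> F"
    using face_ofD[OF assms(2) seg] assms by blast
  then show False
    using assms(3) pq by simp
qed

text \<open>\<open>P\<close> equals the intersection of its tightest integral gap constraints: a segment leaving
  \<open>P\<close> crosses a facet, and beyond it the constraint of the wall containing that facet fails.\<close>

lemma chain_cover_imp_alcoved:
  fixes P :: "(real ^ 'n::{finite,linorder}) set"
  assumes P: "polytope P" "aff_dim P = int CARD('n) - 1" "P \<subseteq> sum_hyperplane k"
    and cover: "P = \<Union>(chain_simplices k P)"
  shows "alcoved_polytope k P"
proof -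
  have conv: "convex P" and bd: "bounded P" and cl: "closed P"
    using P by (auto simp: polytope_imp_convex polytope_imp_bounded polytope_imp_closed)
  have ne: "P \<noteq> {}" using P(2) by auto
  have lin: "linear (\<lambda>z :: (real, 'n) vec. psum j z - psum i z)" for i j
    by (intro linearI) (simp_all add: algebra_simps)
  \<comment> \<open>The least integer that bounds the gap on \<open>P\<close>, whether or not the
    supremum is an integer; \<open>c_ub\<close> and \<open>c_least\<close> express this.\<close>
  define c where "c i j = \<lceil>SUP x\<in>P. psum j x - psum i x\<rceil>" for i j
  have bdd: "bdd_above ((\<lambda>x. psum j x - psum i x) ` P)" for i j
  proof -
    have "compact ((\<lambda>x. psum j x - psum i x) ` P)"
      using P(1) by (intro compact_continuous_image continuous_intros) (simp add: polytope_imp_compact)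
    then show ?thesis by (simp add: bounded_imp_bdd_above compact_imp_bounded)
  qed
  have c_ub: "psum j x - psum i x \<le> of_int (c i j)" if "x \<in> P" for x i j
    using cSUP_upper[OF that bdd, of j i] unfolding c_def by linarith
  have c_least: "c i j \<le> l" if "\<And>x. x \<in> P \<Longrightarrow> psum j x - psum i x \<le> of_int l" for i j l
    unfolding c_def using ne that by (simp add: ceiling_le_iff cSUP_least)
  let ?Q = "{z :: (real, 'n) vec. z \<in> sum_hyperplane k \<and> (\<forall>i<CARD('n). \<forall>j<CARD('n). i \<noteq> j \<longrightarrow> psum j z - psum i z \<le> of_int (c i j))}"
  have "?Q \<subseteq> P"
  proof
    fix z assume z: "z \<in> ?Q"
    show "z \<in> P"
    proof (rule ccontr)
      assume zP: "z \<notin> P"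
      obtain p where p: "p \<in> rel_interior P"
        using ne conv by (metis ex_in_conv rel_interior_eq_empty)
      then have pP: "p \<in> P" using rel_interior_subset by blast
      have "affine hull P = sum_hyperplane k"
        using affine_dim_equal[of "affine hull P" "sum_hyperplane k"] P(2,3) ne
          hull_minimal[of P "sum_hyperplane k" affine]
        by (simp add: affine_sum_hyperplane aff_dim_sum_hyperplane)
      then have "p + (z - p) \<in> affine hull P" using z by simp
      moreover have "z - p \<noteq> 0" using zP pP by auto
      \<comment> \<open>The ray from the relative interior point \<open>p\<close> towards
        \<open>z\<close> leaves \<open>P\<close> at time \<open>d\<close>. As \<open>z\<close> is
        outside \<open>P\<close>, this happens strictly before time 1.\<close>
      ultimately obtain d where d: "0 < d" "p + d *\<^sub>R (z - p) \<in> rel_frontier P"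
        and dlt: "\<And>e. 0 \<le> e \<Longrightarrow> e < d \<Longrightarrow> p + e *\<^sub>R (z - p) \<in> rel_interior P"
        using ray_to_rel_frontier[OF bd p] by metis
      let ?w = "p + d *\<^sub>R (z - p)"
      have fr: "rel_frontier P = P - rel_interior P"
        using cl by (simp add: rel_frontier_def)
      have "d \<le> 1"
        using dlt[of 1] zP rel_interior_subset[of P] by fastforce
      moreover have "d \<noteq> 1"
      proof
        assume "d = 1"
        then have "z \<in> rel_frontier P" using d(2) by simp
        then show False using zP unfolding fr by blast
      qed
      ultimately have d1: "d < 1" by simp
      have "?w \<in> \<Union>{F. F facet_of P}"
        using d(2) fr rel_boundary_of_polyhedron[of P] P(1) by (simp add: polytope_imp_polyhedron)
      then obtain F where F: "F facet_of P" "?w \<in> F" by blast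
      obtain i j l where ij: "i < j" "j < CARD('n)" and Feq: "F = P \<inter> {x. psum j x - psum i x = of_int l}"
        by (rule facet_in_wall[OF P cover F(1)])
      define f where "f x = psum j x - psum i x" for x :: "(real, 'n) vec"
      have Fface: "F face_of P" using F by (simp add: facet_of_imp_face_of)
      have "p \<notin> F"
      proof
        assume "p \<in> F"
        then have "P \<subseteq> F"
          using subset_of_face_of[OF Fface, of P] p by blast
        then show False
          using F(1) face_of_imp_subset[OF Fface] by (auto simp: facet_of_def)
      qed
      then have fp: "f p \<noteq> of_int l" using pP Feq by (auto simp: f_def)
      have fw: "f ?w = of_int l" using F(2) Feq by (auto simp: f_def)
      have fz: "f ?w = f p + d * (f z - f p)"
        by (simp add: f_def algebra_simps)
      have side: "\<not> (f a < of_int l \<and> of_int l < f b)" if "a \<in> P" "b \<in> P" for a b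
        using face_wall_one_sided[OF conv Fface Feq lin that] by (simp add: f_def)
      have ij': "i < CARD('n)" "i \<noteq> j" using ij by auto
      \<comment> \<open>Since \<open>p\<close> is strictly on one side of the wall, all of
        \<open>P\<close> is weakly on that side, so the tightest bound is at least as strong as the
        one given by \<open>l\<close>. The point \<open>z\<close> obeys it, yet the level
        \<open>l\<close> is already attained at \<open>?w\<close>, strictly between \<open>p\<close>
        and \<open>z\<close>.\<close>
      show False
      proof (cases "f p < of_int l")
        case True
        then have "f y \<le> of_int l" if "y \<in> P" for y
          using side[OF pP that] by simp
        then have "c i j \<le> l"
          unfolding f_def by (rule c_least)
        then have "f z \<le> of_int l"
        proof -
          have "f z \<le> of_int (c i j)" using z ij ij' by (simp add: f_def)
          also have "\<dots> \<le> of_int l" using \<open>c i j \<le> l\<close> by simp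
          finally show ?thesis .
        qed
        then have "d * (f z - f p) \<le> d * (of_int l - f p)"
          using d by (intro mult_left_mono) auto
        also have "\<dots> < 1 * (of_int l - f p)"
          using d1 True by (intro mult_strict_right_mono) auto
        finally show False using fw fz by simp
      next
        case False
        then have gt: "of_int l < f p" using fp by simp
        then have "psum i y - psum j y \<le> of_int (- l)" if "y \<in> P" for y
          using side[OF that pP] by (simp add: f_def)
        then have "c j i \<le> - l"
          by (rule c_least)
        moreover have "- f z \<le> of_int (c j i)"
          using z ij ij' by (simp add: f_def)
        ultimately have "- f z \<le> - of_int l"
          by (metis of_int_le_iff of_int_minus order_trans)
        then have "d * (f p - f z) \<le> d * (f p - of_int l)"
          using d by (intro mult_left_mono) auto
        also have "\<dots> < 1 * (f p - of_int l)"
          using d1 gt by (intro mult_strict_right_mono) auto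
        finally show False using fw fz by (simp add: algebra_simps)
      qed
    qed
  qed
  moreover have "P \<subseteq> ?Q"
    using P(3) c_ub by blast
  ultimately have "P = ?Q" by blast
  with P(1) show ?thesis by (rule alcoved_polytopeI)
qed

subsection \<open>Sorted multisets\<close>

text \<open>Partial sums kept in \<open>nat\<close>, so that halving is \<open>div\<close> and its
  rounding is decidable arithmetic.\<close>

definition cnt :: "nat \<Rightarrow> 'n::{finite,linorder} multiset \<Rightarrow> nat" where
  "cnt j M = (\<Sum>m | idx m < j. count M m)"

definition vec_of_mset :: "'n::{finite,linorder} multiset \<Rightarrow> real ^ 'n::{finite,linorder}" where
  "vec_of_mset M = (\<chi> m. real (count M m))"

lemma cnt_eq_size: "cnt j M = size (filter_mset (\<lambda>m. idx m < j) M)"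
proof (induction M)
  case (add x M)
  have "cnt j (add_mset x M) = (\<Sum>m | idx m < j. count M m + (if m = x then 1 else 0))"
    unfolding cnt_def by (rule sum.cong) auto
  also have "\<dots> = cnt j M + (if idx x < j then 1 else 0)"
    unfolding cnt_def by (simp add: sum.distrib)
  finally show ?case using add by simp
qed (simp add: cnt_def)

lemma psum_vec_of_mset: "psum j (vec_of_mset M) = real (cnt j M)"
  by (simp add: psum_def vec_of_mset_def cnt_def)

lemma count_index_mset: "count (index_mset a) m = nat \<lfloor>a $ m\<rfloor>"
  by (simp add: index_mset_def count_sum)

lemma index_mset_vec_of_mset: "index_mset (vec_of_mset M) = M"
  by (rule multiset_eqI) (simp add: count_index_mset vec_of_mset_def)

lemma vec_of_mset_index_mset:
  assumes "a \<in> lattice_points P" "\<And>i. 0 \<le> a $ i"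
  shows "vec_of_mset (index_mset a) = a"
proof -
  have "of_int \<lfloor>a $ i\<rfloor> = a $ i" for i
    using assms by (simp add: lattice_points_def)
  then show ?thesis
    using assms(2) by (simp add: vec_eq_iff vec_of_mset_def count_index_mset)
qed

lemma cnt_index_mset:
  assumes "a \<in> lattice_points P" "\<And>i. 0 \<le> a $ i"
  shows "real (cnt j (index_mset a)) = psum j a"
  by (metis assms psum_vec_of_mset vec_of_mset_index_mset)

lemma mset_eq_iff_cnt: "M = N \<longleftrightarrow> (\<forall>j. cnt j M = cnt j N)"
proof
  assume "\<forall>j. cnt j M = cnt j N"
  then have "vec_of_mset M = vec_of_mset N"
    by (intro psum_eqI) (simp add: psum_vec_of_mset)
  then show "M = N"
    by (metis index_mset_vec_of_mset)
qed simp

text \<open>In a sorted list a downward closed \<open>Q\<close> holds exactly on a prefix. Positions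
  start at 0, so the even ones get the extra element of an odd prefix. In the induction, dropping
  the head swaps the two parities.\<close>

lemma length_filter_nths_alternating:
  fixes xs :: "'a::linorder list"
  assumes "sorted xs" and down: "\<And>x y. Q y \<Longrightarrow> x \<le> y \<Longrightarrow> Q x"
  shows "length (filter Q (nths xs {i. even i})) = (length (filter Q xs) + 1) div 2 \<and>
         length (filter Q (nths xs {i. odd i})) = length (filter Q xs) div 2"
  using assms(1)
proof (induction xs)
  case (Cons x xs)
  show ?case
  proof (cases "Q x")
    case True
    then show ?thesis
      using Cons by (simp add: nths_Cons)
  next
    case False
    then have no: "\<not> Q y" if "y \<in> set (x # xs)" for y
      using Cons.prems down that by auto
    then have "filter Q (nths (x # xs) A) = []" for A
      by (meson filter_False in_set_nthsD)
    moreover have "filter Q (x # xs) = []"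
      using no by (meson filter_False)
    ultimately show ?thesis by simp
  qed
qed simp

lemma cnt_mset_nths:
  "cnt j (mset (nths (sorted_list_of_multiset M) A)) =
    length (filter (\<lambda>m. idx m < j) (nths (sorted_list_of_multiset M) A))"
  by (simp add: cnt_eq_size flip: mset_filter)

lemma length_filter_sorted_list_of_multiset:
  "length (filter (\<lambda>m. idx m < j) (sorted_list_of_multiset M)) = cnt j M"
  by (metis cnt_eq_size mset_filter mset_sorted_list_of_multiset size_mset)

lemma cnt_add: "cnt j (M + N) = cnt j M + cnt j N"
  by (simp add: cnt_eq_size)

text \<open>In terms of partial sums, sorting takes the average of the two multisets, rounded up for
  \<open>sort_U\<close> and down for \<open>sort_V\<close>.\<close>

lemma cnt_sort_U: "cnt j (sort_U I J) = (cnt j I + cnt j J + 1) div 2"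
  and cnt_sort_V: "cnt j (sort_V I J) = (cnt j I + cnt j J) div 2"
proof -
  have "x \<le> y \<Longrightarrow> idx y < j \<Longrightarrow> idx x < j" for x y :: 'a
    by (meson idx_le_iff le_less_trans)
  then have *: "length (filter (\<lambda>m. idx m < j) (nths (sorted_list_of_multiset (I + J)) {i. even i})) =
        (cnt j (I + J) + 1) div 2"
      "length (filter (\<lambda>m. idx m < j) (nths (sorted_list_of_multiset (I + J)) {i. odd i})) =
        cnt j (I + J) div 2"
    using length_filter_nths_alternating[OF sorted_sorted_list_of_multiset, of "\<lambda>m. idx m < j" "I + J"]
    unfolding length_filter_sorted_list_of_multiset by blast+
  show "cnt j (sort_U I J) = (cnt j I + cnt j J + 1) div 2"
    unfolding sort_U_def cnt_mset_nths *(1) cnt_add ..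
  show "cnt j (sort_V I J) = (cnt j I + cnt j J) div 2"
    unfolding sort_V_def cnt_mset_nths *(2) cnt_add ..
qed

lemma sorted_pair_iff: "sorted_pair I J \<longleftrightarrow> (\<forall>j. cnt j J \<le> cnt j I \<and> cnt j I \<le> cnt j J + 1)"
proof -
  have "m = (m + n + 1) div 2 \<and> n = (m + n) div 2 \<longleftrightarrow> n \<le> m \<and> m \<le> n + 1" for m n :: nat
    by presburger
  then show ?thesis
    unfolding sorted_pair_def mset_eq_iff_cnt cnt_sort_U cnt_sort_V by blast
qed

text \<open>The order is reversed: the earlier member of a sorted pair has the larger partial
  sums.\<close>

lemma sorted_pair_index_mset:
  assumes "a \<in> lattice_points P" "b \<in> lattice_points P" "\<And>i. 0 \<le> a $ i" "\<And>i. 0 \<le> b $ i"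
  shows "sorted_pair (index_mset a) (index_mset b) \<longleftrightarrow> near b a"
proof -
  have "psum j a = real (cnt j (index_mset a))" "psum j b = real (cnt j (index_mset b))" for j
    using cnt_index_mset assms by metis+
  moreover have "real m \<le> real n + 1 \<longleftrightarrow> m \<le> n + 1" for m n
    by linarith
  ultimately show ?thesis
    unfolding sorted_pair_iff near_def by simp
qed

text \<open>If both gaps are at most the integer \<open>c\<close>, then adding up and halving with
  the same rounding at \<open>i\<close> and \<open>j\<close> gives a gap of at most
  \<open>c\<close>. The parameter \<open>r\<close> is 1 for \<open>sort_U\<close> and 0 for
  \<open>sort_V\<close>.\<close>

lemma alcoved_imp_sort_closed:
  fixes P :: "(real ^ 'n::{finite,linorder}) set"
  assumes alc: "alcoved_polytope k P" and nonneg: "\<forall>x\<in>P. \<forall>i. 0 \<le> x $ i"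
  shows "sort_closed (index_mset ` lattice_points P)"
proof -
  have H: "P \<subseteq> sum_hyperplane k"
    using alc unfolding alcoved_polytope_def by blast
  have mem: "M \<in> index_mset ` lattice_points P"
    if ab: "a \<in> lattice_points P" "b \<in> lattice_points P"
      and r: "r \<in> {0, 1}" and M: "\<And>j. cnt j M = (cnt j (index_mset a) + cnt j (index_mset b) + r) div 2"
    for a b :: "(real, 'n) vec" and M r
  proof -
    have aP: "a \<in> P" "b \<in> P"
      using ab by (auto simp: lattice_points_def)
    have psa: "psum j a = real (cnt j (index_mset a))" and psb: "psum j b = real (cnt j (index_mset b))" for j
      using cnt_index_mset[OF ab(1)] cnt_index_mset[OF ab(2)] aP nonneg by metis+
    have "vec_of_mset M \<in> P"
    proof (rule alcoved_polytope_memI[OF alc, of "{a, b}"])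
      show "{a, b} \<subseteq> P" using aP by blast
      have "a \<in> sum_hyperplane k" "b \<in> sum_hyperplane k"
        using aP H by auto
      then have "real (cnt CARD('n) (index_mset a)) = of_int k" "real (cnt CARD('n) (index_mset b)) = of_int k"
        unfolding mem_sum_hyperplane psa psb by auto
      then have "cnt CARD('n) (index_mset b) = cnt CARD('n) (index_mset a)"
        "int (cnt CARD('n) (index_mset a)) = k"
        by linarith+
      \<comment> \<open>Both totals equal \<open>k\<close>, and halving \<open>2 k + r\<close>
        returns \<open>k\<close> for either \<open>r\<close>.\<close>
      then show "vec_of_mset M \<in> sum_hyperplane k"
        using r by (auto simp: mem_sum_hyperplane psum_vec_of_mset M simp flip: mult_2)
    next
      fix i j and c :: int
      assume "\<And>x. x \<in> {a, b} \<Longrightarrow> psum j x - psum i x \<le> of_int c"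
      then have "psum j a - psum i a \<le> of_int c" "psum j b - psum i b \<le> of_int c"
        by auto
      then have "int (cnt j (index_mset a)) - int (cnt i (index_mset a)) \<le> c"
          "int (cnt j (index_mset b)) - int (cnt i (index_mset b)) \<le> c"
        unfolding psa psb by linarith+
      then have "int (cnt j M) - int (cnt i M) \<le> c"
        unfolding M by linarith
      then show "psum j (vec_of_mset M) - psum i (vec_of_mset M) \<le> of_int c"
        unfolding psum_vec_of_mset by linarith
    qed
    moreover have "vec_of_mset M $ i \<in> \<int>" for i
      by (simp add: vec_of_mset_def)
    ultimately have "vec_of_mset M \<in> lattice_points P"
      by (simp add: lattice_points_def)
    then show ?thesis
      by (metis imageI index_mset_vec_of_mset)
  qed
  show ?thesis
    unfolding sort_closed_def
    using mem[of _ _ 1] mem[of _ _ 0] by (auto simp: cnt_sort_U cnt_sort_V)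
qed

section \<open>Listing a chain in decreasing order\<close>

definition height :: "real ^ 'n::{finite,linorder} \<Rightarrow> real" where
  "height v = (\<Sum>j<CARD('n). psum j v)"

text \<open>The indices 0 and \<open>n\<close> are left out because the sums there are constant on
  the hyperplane. Hence at most \<open>n - 1\<close> sums can be raised.\<close>

definition raised :: "real ^ 'n::{finite,linorder} \<Rightarrow> real ^ 'n::{finite,linorder} \<Rightarrow> nat set" where
  "raised w v = {j \<in> {1..<CARD('n)}. psum j v = psum j w + 1}"

lemma near_raised:
  fixes v w :: "real ^ 'n::{finite,linorder}"
  assumes vw: "v \<in> lattice_points (sum_hyperplane k)" "w \<in> lattice_points (sum_hyperplane k)"
    and near: "near w v"
  shows "psum j v = psum j w + of_bool (j \<in> raised w v)"
    and "height v - height w = real (card (raised w v))"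
proof -
  have *: "psum j v = psum j w + of_bool (j \<in> raised w v)" for j
  proof (cases "j \<in> {1..<CARD('n)}")
    case True
    obtain a b where "psum j v = of_int a" "psum j w = of_int b"
      using psum_lattice[OF vw(1), of j] psum_lattice[OF vw(2), of j] by (meson Ints_cases)
    moreover have "psum j w \<le> psum j v" "psum j v \<le> psum j w + 1"
      using near by (auto simp: near_def)
    ultimately have "b = a \<or> b = a - 1" by linarith
    then show ?thesis
      using True \<open>psum j v = of_int a\<close> \<open>psum j w = of_int b\<close> by (auto simp: raised_def)
  next
    case False
    then have "j = 0 \<or> CARD('n) \<le> j" by auto
    then have "psum j v = psum j w"
      using vw psum_hyperplane_ge[of v k j] psum_hyperplane_ge[of w k j] by (auto simp: lattice_points_def)
    then show ?thesis using False by (simp add: raised_def)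
  qed
  then show "psum j v = psum j w + of_bool (j \<in> raised w v)" .
  have "height v - height w = (\<Sum>j<CARD('n). psum j v - psum j w)"
    by (simp add: height_def sum_subtractf)
  also have "\<dots> = (\<Sum>j<CARD('n). of_bool (j \<in> raised w v))"
    using * by (intro sum.cong) auto
  also have "\<dots> = real (card ({..<CARD('n)} \<inter> raised w v))"
    by (simp add: sum_of_bool_eq Int_def)
  also have "{..<CARD('n)} \<inter> raised w v = raised w v"
    by (auto simp: raised_def)
  finally show "height v - height w = real (card (raised w v))" .
qed

lemma finite_raised: "finite (raised w v)"
  by (simp add: raised_def)

lemma raised_empty:
  fixes v w :: "real ^ 'n::{finite,linorder}"
  assumes "v \<in> lattice_points (sum_hyperplane k)" "w \<in> lattice_points (sum_hyperplane k)"
    and "near w v" "raised w v = {}"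
  shows "v = w"
  using near_raised(1)[OF assms(1-3)] assms(4) by (intro psum_eqI) simp

text \<open>The height is a strict rank on a chain: the difference in height of two comparable
  elements counts the raised sums, so equal heights force equality. Sorting by decreasing height
  therefore sorts by \<open>near\<close>.\<close>

lemma chain_decreasing_list:
  fixes D :: "(real ^ 'n::{finite,linorder}) set"
  assumes D: "alcove_chain k D"
  obtains xs where "set xs = D" "distinct xs" "sorted_wrt (\<lambda>v w. near w v) xs"
proof -
  obtain ys where ys: "set ys = D" "distinct ys"
    using finite_distinct_list[OF finite_alcove_chain[OF D]] by blast
  let ?xs = "sort_key (\<lambda>v. - height v) ys"
  have lat: "v \<in> lattice_points (sum_hyperplane k)" if "v \<in> D" for v
    using D that by (auto simp: alcove_chain_def)
  have near: "near w v" if vw: "v \<in> D" "w \<in> D" "height w \<le> height v" for v w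
  proof (rule ccontr)
    assume no: "\<not> near w v"
    then have vw': "near v w"
      using D vw unfolding alcove_chain_def by blast
    then have "card (raised v w) = 0"
      using near_raised(2)[OF lat[OF vw(2)] lat[OF vw(1)] vw'] vw(3) by simp
    then have "w = v"
      using raised_empty[OF lat[OF vw(2)] lat[OF vw(1)] vw'] finite_raised[of v w] by simp
    then show False using no vw' by simp
  qed
  have "sorted (map (\<lambda>v. - height v) ?xs)"
    by simp
  then have "sorted_wrt (\<lambda>v w. - height v \<le> - height w) ?xs"
    by (simp only: sorted_wrt_map)
  then have "sorted_wrt (\<lambda>v w. near w v) ?xs"
    by (rule sorted_wrt_mono_rel[rotated]) (use near ys in auto)
  then show thesis
    using that[of ?xs] ys by simp
qed

text \<open>A sorted collection is a decreasingly listed chain. The dimension of its hull excludes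
  repetitions, so it has \<open>n\<close> distinct elements.\<close>

lemma sorted_simplices_eq_chain_simplices:
  fixes P :: "(real ^ 'n::{finite,linorder}) set"
  assumes H: "P \<subseteq> sum_hyperplane k" and nonneg: "\<forall>x\<in>P. \<forall>i. 0 \<le> x $ i"
  shows "sorted_simplices P = chain_simplices k P"
proof (intro equalityI subsetI)
  have sp: "sorted_pair (index_mset v) (index_mset w) \<longleftrightarrow> near w v"
    if "v \<in> lattice_points P" "w \<in> lattice_points P" for v w
    using that nonneg by (intro sorted_pair_index_mset) (auto simp: lattice_points_def)
  {
    fix S assume "S \<in> sorted_simplices P"
    then obtain as where as: "length as = CARD('n)" "set as \<subseteq> lattice_points P"
        "sorted_wrt sorted_pair (map index_mset as)" "(int CARD('n) - 1) simplex S"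
      and S: "S = convex hull (set as)"
      unfolding sorted_simplices_def sorted_collection_def by blast
    have "near v w \<or> near w v" if vw: "v \<in> set as" "w \<in> set as" for v w
    proof -
      obtain s t where st: "s < length as" "t < length as" "v = as ! s" "w = as ! t"
        using vw by (metis in_set_conv_nth)
      have "near (as ! q) (as ! p)" if "p < q" "q < length as" for p q
      proof -
        have "sorted_pair (index_mset (as ! p)) (index_mset (as ! q))"
          using sorted_wrt_nth_less[OF as(3), of p q] that by simp
        then show ?thesis
          using sp[of "as ! p" "as ! q"] as(2) that by (meson nth_mem less_trans subsetD)
      qed
      moreover have "near v v" by (simp add: near_def)
      ultimately show ?thesis
        using st by (metis linorder_neqE_nat)
    qed
    then have chain: "alcove_chain k (set as)"
      using as(2) H unfolding alcove_chain_def lattice_points_def by blast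
    have "aff_dim S = int CARD('n) - 1"
      using as(4) by (rule aff_dim_simplex)
    then have "card (set as) = CARD('n)"
      using aff_dim_alcove_chain[OF chain] S by simp
    then show "S \<in> chain_simplices k P"
      using chain as(2) S unfolding chain_simplices_def full_chains_def lattice_points_def by blast
  next
    fix S assume "S \<in> chain_simplices k P"
    then obtain D where D: "alcove_chain k D" "D \<subseteq> P" "card D = CARD('n)" and S: "S = convex hull D"
      unfolding chain_simplices_def full_chains_def by blast
    obtain xs where xs: "set xs = D" "distinct xs" "sorted_wrt (\<lambda>v w. near w v) xs"
      by (rule chain_decreasing_list[OF D(1)])
    have lat: "D \<subseteq> lattice_points P"
      using D unfolding alcove_chain_def lattice_points_def by blast
    have "sorted_wrt (\<lambda>v w. sorted_pair (index_mset v) (index_mset w)) xs"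
      using xs(3) by (rule sorted_wrt_mono_rel[rotated]) (use sp lat xs(1) in auto)
    then have "sorted_collection (map index_mset xs)"
      by (simp add: sorted_collection_def sorted_wrt_map)
    moreover have "length xs = CARD('n)"
      using xs D by (metis distinct_card)
    moreover have "(int CARD('n) - 1) simplex (convex hull (set xs))"
      using alcove_chain_independent[OF D(1)] D(3) xs(1) unfolding simplex_def by (intro exI[of _ D]) simp
    ultimately show "S \<in> sorted_simplices P"
      using xs(1) lat S unfolding sorted_simplices_def by blast
  }
qed

subsection \<open>Minimal circuits\<close>

lemma psum_cyclic_step:
  fixes a :: "real ^ 'n::{finite,linorder}"
  shows "psum j (a + axis (cyclic_succ i) 1 - axis i 1) =
    psum j a + (if j \<in> {1..<CARD('n)}
      then of_bool (Suc (idx i) = CARD('n)) - of_bool (Suc (idx i) = j) else 0)"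
proof -
  have "idx i < CARD('n)" by (rule idx_bound)
  then show ?thesis
    by (auto simp: psum_axis idx_cyclic_succ simp del: idx_bound)
qed

text \<open>Replaces the recursive description of a walk by an indexed vertex sequence, the form in
  which steps are counted.\<close>

lemma (in pre_digraph) cas_nth:
  assumes "cas u p v"
  shows "awalk_verts u p ! 0 = u" "awalk_verts u p ! length p = v"
    and "t < length p \<Longrightarrow> tail G (p ! t) = awalk_verts u p ! t"
    and "t < length p \<Longrightarrow> head G (p ! t) = awalk_verts u p ! Suc t"
proof -
  have "awalk_verts u p ! 0 = u \<and> awalk_verts u p ! length p = v \<and>
    (\<forall>t<length p. tail G (p ! t) = awalk_verts u p ! t \<and> head G (p ! t) = awalk_verts u p ! Suc t)"
    using assms
  proof (induction p arbitrary: u)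
    case (Cons e p)
    then have "tail G e = u" "cas (head G e) p v" by auto
    from Cons.IH[OF this(2)] this(1) show ?case
      by (auto simp: nth_Cons split: nat.split)
  qed simp
  then show "awalk_verts u p ! 0 = u" "awalk_verts u p ! length p = v"
    and "t < length p \<Longrightarrow> tail G (p ! t) = awalk_verts u p ! t"
    and "t < length p \<Longrightarrow> head G (p ! t) = awalk_verts u p ! Suc t"
    by auto
qed

lemma (in pre_digraph) casI:
  assumes "\<And>t. t < length p \<Longrightarrow> tail G (p ! t) = V t" "\<And>t. t < length p \<Longrightarrow> head G (p ! t) = V (Suc t)"
  shows "cas (V 0) p (V (length p))"
  using assms
proof (induction p arbitrary: V)
  case (Cons e p)
  have "cas (V (Suc 0)) p (V (Suc (length p)))"
    using Cons.prems[of "Suc _"] by (intro Cons.IH[of "\<lambda>t. V (Suc t)"]) auto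
  then show ?case
    using Cons.prems[of 0] by simp
qed simp

text \<open>The step with the last label raises all partial sums at once and every other step lowers one
  of them, so a closed walk uses each label equally often; with \<open>n\<close> steps, exactly once.\<close>

lemma closed_label_walk_chain:
  fixes V :: "nat \<Rightarrow> real ^ 'n::{finite,linorder}"
  assumes step: "\<And>t. t < CARD('n) \<Longrightarrow> V (Suc t) = V t + axis (cyclic_succ (l t)) 1 - axis (l t) 1"
    and closed: "V CARD('n) = V 0" and st: "s \<le> t" "t \<le> CARD('n)"
  shows "near (V s) (V t) \<or> near (V t) (V s)"
proof -
  \<comment> \<open>Labels are numbered from 1, so that label number \<open>r < n\<close> is the one
    lowering the \<open>r\<close>-th partial sum, and number \<open>n\<close> is the last
    label.\<close>
  define N where "N r t = card {s. s < t \<and> Suc (idx (l s)) = r}" for r t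
  have N_Suc: "N r (Suc t) = N r t + of_bool (Suc (idx (l t)) = r)" for r t
  proof -
    have "{s. s < Suc t \<and> Suc (idx (l s)) = r} =
        {s. s < t \<and> Suc (idx (l s)) = r} \<union> (if Suc (idx (l t)) = r then {t} else {})"
      by (auto simp: less_Suc_eq)
    then show ?thesis by (simp add: N_def)
  qed
  have N_mono: "N r s \<le> N r t" if "s \<le> t" for r s t
    unfolding N_def using that by (intro card_mono) auto
  have walk: "psum j (V t) = psum j (V 0) + (if j \<in> {1..<CARD('n)} then real (N CARD('n) t) - real (N j t) else 0)"
    if "t \<le> CARD('n)" for j t
    using that
  proof (induction t)
    case 0
    show ?case by (simp add: N_def)
  next
    case (Suc t)
    then have "psum j (V (Suc t)) = psum j (V t) + (if j \<in> {1..<CARD('n)}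
      then of_bool (Suc (idx (l t)) = CARD('n)) - of_bool (Suc (idx (l t)) = j) else 0)"
      using step[of t] psum_cyclic_step[of j "V t" "l t"] by simp
    then show ?case
      using Suc by (simp add: N_Suc)
  qed
  have eq: "N j CARD('n) = N CARD('n) CARD('n)" if "j \<in> {1..CARD('n)}" for j
    using walk[of "CARD('n)" j] closed that by (cases "j = CARD('n)") auto
  have total: "(\<Sum>r\<in>{1..CARD('n)}. N r t) = t" for t
  proof (induction t)
    case (Suc t)
    have "Suc (idx (l t)) \<in> {1..CARD('n)}"
      using idx_bound[of "l t"] by (simp add: Suc_le_eq)
    then have "(\<Sum>r\<in>{1..CARD('n)}. of_bool (Suc (idx (l t)) = r) :: nat) = 1"
      by (simp add: of_bool_def)
    then show ?case
      using Suc by (simp add: N_Suc sum.distrib)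
  qed (simp add: N_def)
  have "(\<Sum>r\<in>{1..CARD('n)}. N r CARD('n)) = (\<Sum>r\<in>{1..CARD('n)}. N CARD('n) CARD('n))"
    by (intro sum.cong refl eq)
  then have "CARD('n) = CARD('n) * N CARD('n) CARD('n)"
    unfolding total by simp
  then have once: "N j CARD('n) = 1" if "j \<in> {1..CARD('n)}" for j
    using eq[OF that] by simp
  have d01: "N r s \<le> N r t \<and> N r t \<le> N r s + 1" if "r \<in> {1..CARD('n)}" for r
    using once[OF that] N_mono[of s t r] N_mono[of t "CARD('n)" r] st by simp
  have diff: "psum j (V t) = psum j (V s) + (if j \<in> {1..<CARD('n)}
      then (real (N CARD('n) t) - real (N CARD('n) s)) - (real (N j t) - real (N j s)) else 0)" for j
    using walk[of t j] walk[of s j] st by simp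
  have n: "CARD('n) \<in> {1..CARD('n)}" by (simp add: Suc_leI)
  \<comment> \<open>Between times \<open>s\<close> and \<open>t\<close> each label occurs at most
    once. If the last label occurs, every sum changes by 0 or 1, otherwise by 0 or -1; this decides
    which of the two vertices is the lower one.\<close>
  then consider "N CARD('n) t = N CARD('n) s + 1" | "N CARD('n) t = N CARD('n) s"
    using d01[OF n] by linarith
  then show ?thesis
  proof cases
    case 1
    have "near (V s) (V t)"
      unfolding near_def
    proof
      fix j
      show "psum j (V s) \<le> psum j (V t) \<and> psum j (V t) \<le> psum j (V s) + 1"
        using diff[of j] d01[of j] 1 by (cases "j \<in> {1..<CARD('n)}") auto
    qed
    then show ?thesis ..
  next
    case 2
    have "near (V t) (V s)"
      unfolding near_def
    proof
      fix j
      show "psum j (V t) \<le> psum j (V s) \<and> psum j (V s) \<le> psum j (V t) + 1"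
        using diff[of j] d01[of j] 2 by (cases "j \<in> {1..<CARD('n)}") auto
    qed
    then show ?thesis ..
  qed
qed

lemma minimal_circuit_full_chain:
  fixes P :: "(real ^ 'n::{finite,linorder}) set"
  assumes H: "P \<subseteq> sum_hyperplane k" and c: "c \<in> minimal_circuits P"
  shows "set c \<in> full_chains k P"
proof -
  interpret G: pre_digraph "lattice_graph P" .
  let ?n = "CARD('n)"
  obtain p u where c: "c = map (tail (lattice_graph P)) p" and len: "length p = ?n"
    and arcs: "set p \<subseteq> arcs (lattice_graph P)" and cas: "G.cas u p u"
    and dist: "distinct (tl (G.awalk_verts u p))"
    using c unfolding minimal_circuits_def G.cycle_def G.awalk_def by blast
  define V where "V t = G.awalk_verts u p ! t" for t
  define l where "l t = fst (snd (p ! t))" for t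
  have V0: "V 0 = u" "V ?n = u"
    using G.cas_nth[OF cas] len by (auto simp: V_def)
  have arc: "V t \<in> lattice_points P" "V (Suc t) = V t + axis (cyclic_succ (l t)) 1 - axis (l t) 1"
    if t: "t < ?n" for t
  proof -
    have "p ! t \<in> arcs (lattice_graph P)"
      using arcs t len by (metis nth_mem subsetD)
    then have *: "tail (lattice_graph P) (p ! t) \<in> lattice_points P"
      "head (lattice_graph P) (p ! t) =
        tail (lattice_graph P) (p ! t) + axis (cyclic_succ (l t)) 1 - axis (l t) 1"
      by (auto simp: lattice_graph_def l_def)
    then show "V t \<in> lattice_points P" "V (Suc t) = V t + axis (cyclic_succ (l t)) 1 - axis (l t) 1"
      using G.cas_nth(3,4)[OF cas, of t] t len by (simp_all add: V_def)
  qed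
  have set_c: "set c = V ` {..<?n}"
  proof -
    have "c = map V [0..<?n]"
      by (rule nth_equalityI) (simp_all add: c len V_def G.cas_nth(3)[OF cas])
    then show ?thesis by (simp add: atLeast0LessThan)
  qed
  have "near v w \<or> near w v" if vw: "v \<in> set c" "w \<in> set c" for v w
  proof -
    obtain s t where st: "s < ?n" "t < ?n" "v = V s" "w = V t"
      using vw unfolding set_c by blast
    have "near (V a) (V b) \<or> near (V b) (V a)" if "a \<le> b" "b < ?n" for a b
      using that V0 by (intro closed_label_walk_chain[where l=l]) (auto simp: arc(2))
    from this[of s t] this[of t s] show ?thesis
      using st by (cases "s \<le> t") auto
  qed
  moreover have "set c \<subseteq> lattice_points P"
    using arc(1) unfolding set_c by blast
  \<comment> \<open>A cycle has distinct vertices once the starting one is dropped. Since the walk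
    is closed, the remaining vertices are the same set as the tails of its arcs.\<close>
  moreover have "card (set c) = ?n"
  proof -
    let ?ws = "tl (G.awalk_verts u p)"
    have len': "length (G.awalk_verts u p) = Suc ?n"
      using len by (auto simp: G.awalk_verts_conv)
    have "set ?ws = (\<lambda>t. V (Suc t)) ` {..<?n}"
    proof -
      have "?ws = map (\<lambda>t. V (Suc t)) [0..<?n]"
        by (rule nth_equalityI) (simp_all add: len' V_def nth_tl)
      then show ?thesis by (simp add: atLeast0LessThan)
    qed
    also have "\<dots> = V ` {1..?n}"
      by (simp add: image_image[of V Suc, symmetric] image_Suc_lessThan)
    also have "\<dots> = V ` {..<?n}"
    proof -
      have "{1..?n} = insert ?n {1..<?n}" "{..<?n} = insert 0 {1..<?n}"
        by (auto simp: Suc_leI)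
      then show ?thesis using V0 by simp
    qed
    finally have "set c = set ?ws" using set_c by simp
    then show ?thesis
      using distinct_card[OF dist] len' by simp
  qed
  ultimately show ?thesis
    using H unfolding full_chains_def alcove_chain_def lattice_points_def by blast
qed

text \<open>In the decreasing list each of the \<open>n - 1\<close> steps lowers the height by at
  least one, and the total drop is at most \<open>n - 1\<close>. So every step lowers exactly one
  partial sum and is an arc. All sums have then been lowered once, and a step with the last label
  returns to the top.\<close>

lemma full_chain_minimal_circuit:
  fixes P :: "(real ^ 'n::{finite,linorder}) set"
  assumes D: "D \<in> full_chains k P"
  obtains c where "c \<in> minimal_circuits P" "set c = D"
proof -
  interpret G: pre_digraph "lattice_graph P" .
  let ?n = "CARD('n)"
  have chain: "alcove_chain k D" and DP: "D \<subseteq> P" and card: "card D = ?n"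
    using D by (auto simp: full_chains_def)
  obtain xs where xs: "set xs = D" "distinct xs" "sorted_wrt (\<lambda>v w. near w v) xs"
    by (rule chain_decreasing_list[OF chain])
  have len: "length xs = ?n"
    using xs card by (metis distinct_card)
  define m where "m = ?n - 1"
  have nm: "?n = Suc m" by (simp add: m_def)
  have lat: "xs ! t \<in> lattice_points (sum_hyperplane k)" "xs ! t \<in> lattice_points P" if "t < ?n" for t
  proof -
    have "xs ! t \<in> D"
      using that xs(1) len nth_mem by metis
    then show "xs ! t \<in> lattice_points (sum_hyperplane k)" "xs ! t \<in> lattice_points P"
      using chain DP unfolding alcove_chain_def lattice_points_def by blast+
  qed
  have near: "near (xs ! t) (xs ! s)" if "s \<le> t" "t < ?n" for s t
    using sorted_wrt_nth_less[OF xs(3), of s t] that len by (cases "s = t") (auto simp: near_def)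
  have drop: "height (xs ! s) - height (xs ! t) = real (card (raised (xs ! t) (xs ! s)))"
    if "s \<le> t" "t < ?n" for s t
    using near_raised(2)[OF lat(1) lat(1) near[OF that]] that by simp
  have drop1: "height (xs ! t) - height (xs ! Suc t) \<ge> 1" if "Suc t < ?n" for t
  proof -
    have "xs ! t \<noteq> xs ! Suc t"
      using xs(2) that len by (simp add: nth_eq_iff_index_eq)
    then have "raised (xs ! Suc t) (xs ! t) \<noteq> {}"
      using raised_empty[OF lat(1) lat(1) near[of t "Suc t"]] that by auto
    then have "card (raised (xs ! Suc t) (xs ! t)) \<ge> 1"
      by (simp add: Suc_le_eq card_gt_0_iff finite_raised)
    then show ?thesis
      using drop[of t "Suc t"] that by simp
  qed
  have drop_ge: "height (xs ! s) - height (xs ! (s + d)) \<ge> real d" if "s + d < ?n" for s d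
    using that
  proof (induction d)
    case (Suc d)
    then show ?case using drop1[of "s + d"] by simp
  qed simp
  have sub: "raised w v \<subseteq> {1..<?n}" for v w :: "(real, 'n) vec"
    unfolding raised_def by blast
  have "card (raised w v) \<le> m" for v w :: "(real, 'n) vec"
    using card_mono[OF _ sub, of w v] by (simp add: m_def)
  then have total: "height (xs ! 0) - height (xs ! m) \<le> real m"
    using drop[of 0 m] nm by simp
  \<comment> \<open>Reading positions modulo \<open>n\<close> closes the list up: the successor of
    position \<open>m\<close> is the top element.\<close>
  define V where "V t = xs ! (t mod ?n)" for t
  have "\<exists>i. V (Suc t) = V t + axis (cyclic_succ i) 1 - axis i 1" if t: "t < ?n" for t
  proof (cases "Suc t < ?n")
    case True
    have "height (xs ! t) - height (xs ! Suc t) \<le> 1"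
    proof -
      have "height (xs ! 0) - height (xs ! t) \<ge> real t"
        using drop_ge[of 0 t] t by simp
      moreover have "height (xs ! Suc t) - height (xs ! m) \<ge> real (m - Suc t)"
        using drop_ge[of "Suc t" "m - Suc t"] True nm by simp
      moreover have "real (m - Suc t) = real m - real t - 1"
        using True nm by (simp add: of_nat_diff)
      ultimately show ?thesis
        using total by linarith
    qed
    then have "card (raised (xs ! Suc t) (xs ! t)) = 1"
      using drop1[OF True] drop[of t "Suc t"] True by simp
    then obtain j where j: "raised (xs ! Suc t) (xs ! t) = {j}"
      by (rule card_1_singletonE)
    then have jn: "j \<in> {1..<?n}"
      unfolding raised_def by blast
    then have "j - 1 < ?n" by auto
    then obtain i :: 'n where "idx i = j - 1"
      by (rule idx_surj)
    with jn have i: "Suc (idx i) = j" by auto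
    have "xs ! Suc t = xs ! t + axis (cyclic_succ i) 1 - axis i 1"
    proof (rule psum_eqI)
      fix j'
      show "psum j' (xs ! Suc t) = psum j' (xs ! t + axis (cyclic_succ i) 1 - axis i 1)"
        using near_raised(1)[OF lat(1) lat(1) near[of t "Suc t"], of j'] True jn
        unfolding psum_cyclic_step by (auto simp: i j)
    qed
    then show ?thesis
      using True by (auto simp: V_def)
  next
    case False
    then have tn: "t = m" using t nm by simp
    let ?R = "raised (xs ! m) (xs ! 0)"
    have "height (xs ! 0) - height (xs ! m) \<ge> real m"
      using drop_ge[of 0 m] nm by simp
    then have "card ?R = m"
      using drop[of 0 m] total nm by simp
    \<comment> \<open>The drop from top to bottom counts \<open>n - 1\<close> raised sums, which is
      all of them; this is the change made by the last label.\<close>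
    then have R: "?R = {1..<?n}"
      using sub by (intro card_subset_eq) (simp_all add: m_def)
    have "xs ! 0 = xs ! m + axis (cyclic_succ (Max UNIV)) 1 - axis (Max UNIV) 1"
    proof (rule psum_eqI)
      fix j'
      show "psum j' (xs ! 0) = psum j' (xs ! m + axis (cyclic_succ (Max UNIV)) 1 - axis (Max UNIV) 1)"
        using near_raised(1)[OF lat(1) lat(1) near[of 0 m], of j'] nm
        unfolding psum_cyclic_step by (auto simp: R idx_Max)
    qed
    then show ?thesis
      using tn nm by (auto simp: V_def)
  qed
  then obtain l where l: "\<And>t. t < ?n \<Longrightarrow> V (Suc t) = V t + axis (cyclic_succ (l t)) 1 - axis (l t) 1"
    by metis
  define p where "p = map (\<lambda>t. (V t, l t, V (Suc t))) [0..<?n]"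
  have Vlat: "V t \<in> lattice_points P" for t
    using lat(2)[of "t mod ?n"] by (simp add: V_def)
  have plen: "length p = ?n" by (simp add: p_def)
  have tails: "map (tail (lattice_graph P)) p = xs"
    by (rule nth_equalityI) (simp_all add: p_def lattice_graph_def V_def len)
  have VV: "V ?n = V 0" by (simp add: V_def)
  have "G.cas (V 0) p (V (length p))"
    by (rule G.casI) (simp_all add: p_def lattice_graph_def)
  then have cas: "G.cas (V 0) p (V 0)"
    by (simp add: plen VV)
  have "G.awalk (V 0) p (V 0)"
    unfolding G.awalk_def
  proof (intro conjI cas)
    show "V 0 \<in> verts (lattice_graph P)"
      using Vlat by (simp add: lattice_graph_def)
    show "set p \<subseteq> arcs (lattice_graph P)"
    proof
      fix e assume "e \<in> set p"
      then obtain t where "t < ?n" "e = (V t, l t, V (Suc t))"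
        by (auto simp: p_def)
      then show "e \<in> arcs (lattice_graph P)"
        unfolding lattice_graph_def using Vlat[of t] Vlat[of "Suc t"] l[of t] by simp
    qed
  qed
  moreover have "distinct (tl (G.awalk_verts (V 0) p))"
  proof -
    have "p \<noteq> []" using plen by auto
    have "head (lattice_graph P) (last p) = V ?n"
      using G.cas_nth(4)[OF cas, of m] G.cas_nth(2)[OF cas] plen nm VV \<open>p \<noteq> []\<close>
      by (simp add: last_conv_nth)
    then have "G.awalk_verts (V 0) p = xs @ [xs ! 0]"
      using \<open>p \<noteq> []\<close> tails VV by (simp add: G.awalk_verts_conv V_def)
    moreover have "xs \<noteq> []" using len by auto
    ultimately show ?thesis
      using xs(2) by (cases xs) auto
  qed
  moreover have "p \<noteq> []" using plen by auto
  ultimately have "G.cycle p"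
    unfolding G.cycle_def by blast
  then have "xs \<in> minimal_circuits P"
    unfolding minimal_circuits_def using tails plen by blast
  then show thesis
    using that xs(1) by blast
qed

lemma circuit_simplices_eq_chain_simplices:
  assumes "P \<subseteq> sum_hyperplane k"
  shows "circuit_simplices P = chain_simplices k P"
proof (intro equalityI subsetI)
  fix S assume "S \<in> circuit_simplices P"
  then show "S \<in> chain_simplices k P"
    using minimal_circuit_full_chain[OF assms] unfolding circuit_simplices_def chain_simplices_def by blast
next
  fix S assume "S \<in> chain_simplices k P"
  then obtain D where D: "D \<in> full_chains k P" and S: "S = convex hull D"
    unfolding chain_simplices_def by blast
  obtain c where "c \<in> minimal_circuits P" "set c = D"
    by (rule full_chain_minimal_circuit[OF D])
  then show "S \<in> circuit_simplices P"
    using S unfolding circuit_simplices_def by blast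
qed

theorem theorem3p1:
  fixes k :: int and P :: "(real ^ 'n::{finite,linorder}) set"
  assumes "polytope P"
    and "aff_dim P = int CARD('n) - 1"
    and "P \<subseteq> sum_hyperplane k"
    and "\<forall>x\<in>P. \<forall>i. 0 \<le> x $ i"
  shows "(alcoved_polytope k P \<longleftrightarrow>
            sort_closed (index_mset ` lattice_points P) \<and>
            maximal_simplices_of_triangulation (sorted_simplices P) P) \<and>
         (alcoved_polytope k P \<longleftrightarrow>
            maximal_simplices_of_triangulation (circuit_simplices P) P) \<and>
         (alcoved_polytope k P \<longrightarrow>
            maximal_simplices_of_triangulation (alcoves_in k P) P \<and>
            sorted_simplices P = circuit_simplices P \<and>
            circuit_simplices P = alcoves_in k P)"
proof -
  have eq: "sorted_simplices P = chain_simplices k P" "circuit_simplices P = chain_simplices k P"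
    "alcoves_in k P = chain_simplices k P"
    using assms by (simp_all add: sorted_simplices_eq_chain_simplices
        circuit_simplices_eq_chain_simplices alcoves_in_eq_chain_simplices polytope_imp_convex)
  have "alcoved_polytope k P \<longleftrightarrow> maximal_simplices_of_triangulation (chain_simplices k P) P"
    using alcoved_polytope_triangulation[OF _ assms(2)]
      chain_cover_imp_alcoved[OF assms(1-3) maximal_simplices_Union] by blast
  then show ?thesis
    unfolding eq using alcoved_imp_sort_closed[OF _ assms(4)] by blast
qed

end
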